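(* Let $\Sigma$ be a compact Riemann surface, $[\Sigma]\in H_2(\Sigma,\mathbb R)$ its fundamental class in singular homology, and $\lambda>0$ a real number. Then $[\Sigma]$ belongs to the range of the canonical map $$H_2(\Sigma,\Vert H\mathbb R\Vert_\lambda)\to H_2(\Sigma,\mathbb R)$$ if and only if $\lambda$ is (strictly) larger than the Gromov norm of $[\Sigma]$.
   Context: Riemann surfaces are connected and carry their complex orientation. $\Gamma^{\rm op}$ is the category of pointed finite sets $k_+=\{0,1,\dots,k\}$ ($k\ge 0$, base point $0$) with base-point preserving maps. An $\mathfrak s$-module is a pointed covariant functor $M:\Gamma^{\rm op}\to \mathrm{Sets}_*$; it is extended to an endofunctor of pointed sets by filtered colimits over finite pointed subsets. For a pointed simplicial set $X$, $M\circ X$ is the pointed simplicial set $[q]\mapsto M(X_q)$. $H\mathbb R$ is the $\mathfrak s$-module $H\mathbb R(k_+)=\mathbb R^k$ with $H\mathbb R(f)(m)(j)=\sum_{f(\ell)=j}m_\ell$ for $j\ne 0$. As an endofunctor, $H\mathbb R(E)$ is the set of finitely supported maps $\phi:E\to\mathbb R$ vanishing at the base point. For $\lambda>0$, $\Vert H\mathbb R\Vert_\lambda\subset H\mathbb R$ is the sub-$\mathfrak s$-module given (as an endofunctor) by those $\phi$ with $\sum_{x}|\phi(x)|<\lambda$. For a pointed simplicial set $Y$ with base point $*$ and $n\ge0$, let $Z_n(Y)=\{x\in Y_n\mid \partial_jx=*\ \forall j\}$, with relation $xRy$ iff there is $z\in Y_{n+1}$ with $\partial_jz=*$ for $j<n$,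 $\partial_nz=x$, $\partial_{n+1}z=y$; $\pi^{\rm comb}_n(Y)$ is the quotient of $Z_n(Y)$ by the equivalence relation generated by $R$. For a pointed simplicial set $X$ and an $\mathfrak s$-module $M$, $H_n(X,M)$ is the $\mathfrak s$-module $k_+\mapsto \pi_n^{\rm comb}(M\circ(X\wedge k_+))$. For a topological space $X$, $H_n(X,M):=H_n(\sin X,M)$, where $\sin X=\{[n]\mapsto \mathrm{Top}(\Delta^n,X)\}$ is the singular simplicial set, made into a pointed simplicial set by adjoining a disjoint base point. The canonical map $H_2(\Sigma,\Vert H\mathbb R\Vert_\lambda)\to H_2(\Sigma,\mathbb R)$ is induced by the inclusion $\Vert H\mathbb R\Vert_\lambda\subset H\mathbb R$ and the identification $H_2(\Sigma,H\mathbb R)=H(H_2(\Sigma,\mathbb R))$, evaluated at $1_+$. Concretely, an element of $H_2(\Sigma,\Vert H\mathbb R\Vert_\lambda)(1_+)$ is the class of a singular $2$-chain $\phi$ with $\partial_0\phi=\partial_1\phi=\partial_2\phi=0$ and $\ell^1$-norm $<\lambda$, and it is sent to the singular homology class of $\phi$. The Gromov norm of $\alpha\in H_n(X,\mathbb R)$ is $\Vert\alpha\Vert_1=\inf_c\Vert c\Vert_1$ over all singular cycles $c=\sum a_j\sigma_j$ representing $\alpha$, where $\Vert c\Vert_1=\sum|a_j|$ (the $\sigma_j$ being distinct). *)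

theory Defs
  imports "HOL-Homology.Homology" "HOL-Analysis.Complex_Analysis_Basics"
begin

section \<open>Segal's category and s-modules\<close>

text \<open>The pointed set \<open>k\<^sub>+ = {0,...,k}\<close> is represented by \<open>{..k}\<close>; only the values on \<open>{..k}\<close> of a
  morphism \<open>k\<^sub>+ \<rightarrow> l\<^sub>+\<close> are meaningful.\<close>

definition gamma_map :: "nat \<Rightarrow> nat \<Rightarrow> (nat \<Rightarrow> nat) set" where
  "gamma_map k l = {f. f 0 = 0 \<and> f ` {..k} \<subseteq> {..l}}"

record 'm smod =
  sm_set :: "nat \<Rightarrow> 'm set"
  sm_pt :: "nat \<Rightarrow> 'm"
  sm_map :: "nat \<Rightarrow> nat \<Rightarrow> (nat \<Rightarrow> nat) \<Rightarrow> 'm \<Rightarrow> 'm"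

definition s_module :: "'m smod \<Rightarrow> bool" where
  "s_module M \<longleftrightarrow>
     sm_set M 0 = {sm_pt M 0} \<and>
     (\<forall>k. sm_pt M k \<in> sm_set M k) \<and>
     (\<forall>k l. \<forall>f\<in>gamma_map k l. sm_map M k l f \<in> sm_set M k \<rightarrow> sm_set M l
                         \<and> sm_map M k l f (sm_pt M k) = sm_pt M l) \<and>
     (\<forall>k l f g. \<forall>m\<in>sm_set M k. (\<forall>i\<le>k. f i = g i) \<longrightarrow> sm_map M k l f m = sm_map M k l g m) \<and>
     (\<forall>k. \<forall>m\<in>sm_set M k. sm_map M k k id m = m) \<and>
     (\<forall>k l n. \<forall>f\<in>gamma_map k l. \<forall>g\<in>gamma_map l n. \<forall>m\<in>sm_set M k.
        sm_map M k n (g \<circ> f) m = sm_map M l n g (sm_map M k l f m))"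

definition HR_map :: "nat \<Rightarrow> nat \<Rightarrow> (nat \<Rightarrow> nat) \<Rightarrow> (nat \<Rightarrow> real) \<Rightarrow> (nat \<Rightarrow> real)" where
  "HR_map k l f m = (\<lambda>j. if j \<in> {1..l} then (\<Sum>i | i \<le> k \<and> f i = j. m i) else 0)"

text \<open>\<open>\<real>\<^sup>k\<close> is the set of functions \<open>nat \<Rightarrow> real\<close> that vanish outside \<open>{1..k}\<close>.\<close>

definition HR :: "(nat \<Rightarrow> real) smod" where
  "HR = \<lparr>sm_set = (\<lambda>k. {m. \<forall>i. i \<notin> {1..k} \<longrightarrow> m i = 0}), sm_pt = (\<lambda>k i. 0), sm_map = HR_map\<rparr>"

definition HR_norm :: "real \<Rightarrow> (nat \<Rightarrow> real) smod" where
  "HR_norm lam =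
     \<lparr>sm_set = (\<lambda>k. {m \<in> sm_set HR k. (\<Sum>i=1..k. \<bar>m i\<bar>) < lam}),
      sm_pt = sm_pt HR, sm_map = sm_map HR\<rparr>"

lemma HR_map_comp:
  assumes f: "f \<in> gamma_map k l" and g: "g \<in> gamma_map l n"
  shows "HR_map k n (g \<circ> f) m = HR_map l n g (HR_map k l f m)"
proof
  fix j
  show "HR_map k n (g \<circ> f) m j = HR_map l n g (HR_map k l f m) j"
  proof (cases "j \<in> {1..n}")
    case True
    have fl: "f i \<le> l" if "i \<le> k" for i
      using f that by (auto simp: gamma_map_def)
    have g0: "g 0 = 0" using g by (simp add: gamma_map_def)
    have "HR_map k n (g \<circ> f) m j = (\<Sum>i | i \<le> k \<and> g (f i) = j. m i)"
      using True by (simp add: HR_map_def)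
    also have "\<dots> = (\<Sum>p | p \<le> l \<and> g p = j. \<Sum>i | i \<in> {i. i \<le> k \<and> g (f i) = j} \<and> f i = p. m i)"
      by (rule sum.group [symmetric]) (use fl in auto)
    also have "\<dots> = (\<Sum>p | p \<le> l \<and> g p = j. HR_map k l f m p)"
    proof (rule sum.cong)
      fix p assume p: "p \<in> {p. p \<le> l \<and> g p = j}"
      then have "p \<in> {1..l}" using g0 True by (cases "p = 0") auto
      moreover have "{i. i \<in> {i. i \<le> k \<and> g (f i) = j} \<and> f i = p} = {i. i \<le> k \<and> f i = p}"
        using p by auto
      ultimately show "(\<Sum>i | i \<in> {i. i \<le> k \<and> g (f i) = j} \<and> f i = p. m i) = HR_map k l f m p"
        by (simp add: HR_map_def)
    qed simp
    also have "\<dots> = HR_map l n g (HR_map k l f m) j"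
      using True by (simp add: HR_map_def)
    finally show ?thesis .
  next
    case False
    then show ?thesis unfolding HR_map_def by (simp only: if_False)
  qed
qed

lemma HR_map_id: "(\<And>i. i \<notin> {1..k} \<Longrightarrow> m i = 0) \<Longrightarrow> HR_map k k id m = m"
proof
  fix j assume *: "\<And>i. i \<notin> {1..k} \<Longrightarrow> m i = 0"
  have "{i. i \<le> k \<and> i = j} = {j}" if "j \<in> {1..k}" using that by auto
  then show "HR_map k k id m j = m j" using * by (auto simp: HR_map_def)
qed

lemma HR_map_cong: "(\<And>i. i \<le> k \<Longrightarrow> f i = g i) \<Longrightarrow> HR_map k l f m = HR_map k l g m"
  unfolding HR_map_def by (intro ext if_cong sum.cong) auto

lemma HR_map_norm:
  assumes "f \<in> gamma_map k l"
  shows "(\<Sum>j=1..l. \<bar>HR_map k l f m j\<bar>) \<le> (\<Sum>i=1..k. \<bar>m i\<bar>)"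
proof -
  have f0: "f 0 = 0" using assms by (simp add: gamma_map_def)
  have "(\<Sum>j=1..l. \<bar>HR_map k l f m j\<bar>) \<le> (\<Sum>j=1..l. \<Sum>i | i \<in> {i. i \<le> k \<and> f i \<in> {1..l}} \<and> f i = j. \<bar>m i\<bar>)"
  proof (rule sum_mono)
    fix j assume j: "j \<in> {1..l}"
    then have "{i. i \<in> {i. i \<le> k \<and> f i \<in> {1..l}} \<and> f i = j} = {i. i \<le> k \<and> f i = j}" by auto
    then show "\<bar>HR_map k l f m j\<bar> \<le> (\<Sum>i | i \<in> {i. i \<le> k \<and> f i \<in> {1..l}} \<and> f i = j. \<bar>m i\<bar>)"
      using j by (simp add: HR_map_def sum_abs)
  qed
  also have "\<dots> = (\<Sum>i | i \<le> k \<and> f i \<in> {1..l}. \<bar>m i\<bar>)"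
    by (rule sum.group) auto
  also have "\<dots> \<le> (\<Sum>i=1..k. \<bar>m i\<bar>)"
    by (rule sum_mono2) (auto simp: f0 Suc_le_eq intro!: gr0I)
  finally show ?thesis .
qed

lemma HR_map_outside: "j \<notin> {1..l} \<Longrightarrow> HR_map k l f m j = 0"
  unfolding HR_map_def by (simp only: if_False)

lemma HR_map_zero: "HR_map k l f (\<lambda>i. 0) = (\<lambda>i. 0)"
  by (simp add: HR_map_def fun_eq_iff)

lemma HR_sel: "sm_set HR k = {m. \<forall>i. i \<notin> {1..k} \<longrightarrow> m i = 0}" "sm_pt HR k = (\<lambda>i. 0)" "sm_map HR = HR_map"
  by (simp_all add: HR_def)

lemma HR_norm_sel:
  "sm_set (HR_norm lam) k = {m \<in> sm_set HR k. (\<Sum>i=1..k. \<bar>m i\<bar>) < lam}"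
  "sm_pt (HR_norm lam) = sm_pt HR" "sm_map (HR_norm lam) = sm_map HR"
  by (simp_all add: HR_norm_def)

lemma s_module_HR: "s_module HR"
  unfolding s_module_def
proof (intro conjI allI ballI impI)
  show "sm_set HR 0 = {sm_pt HR 0}" by (auto simp: HR_sel)
  show "sm_map HR k k id m = m" if "m \<in> sm_set HR k" for k m
    unfolding HR_sel by (rule HR_map_id) (use that in \<open>simp add: HR_sel\<close>)
  show "sm_map HR k l f m = sm_map HR k l g m" if "\<forall>i\<le>k. f i = g i" for k l f g m
    unfolding HR_sel by (rule HR_map_cong) (use that in simp)
  show "sm_map HR k l f \<in> sm_set HR k \<rightarrow> sm_set HR l" for k l f
    unfolding HR_sel using HR_map_outside by blast
  show "sm_map HR k n (g \<circ> f) m = sm_map HR l n g (sm_map HR k l f m)"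
    if "f \<in> gamma_map k l" "g \<in> gamma_map l n" for k l n f g m
    unfolding HR_sel using that by (rule HR_map_comp)
qed (simp_all add: HR_sel HR_map_zero)

lemma s_module_HR_norm:
  assumes "lam > 0"
  shows "s_module (HR_norm lam)"
  unfolding s_module_def
proof (intro conjI allI ballI impI)
  show "sm_set (HR_norm lam) 0 = {sm_pt (HR_norm lam) 0}"
    using assms by (auto simp: HR_norm_sel HR_sel)
  show "sm_pt (HR_norm lam) k \<in> sm_set (HR_norm lam) k" for k
    using assms by (simp add: HR_norm_sel HR_sel)
  show "sm_map (HR_norm lam) k l f \<in> sm_set (HR_norm lam) k \<rightarrow> sm_set (HR_norm lam) l"
    if "f \<in> gamma_map k l" for k l f
  proof -
    have "HR_map k l f \<in> sm_set HR k \<rightarrow> sm_set HR l"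
      unfolding HR_sel using HR_map_outside by blast
    then show ?thesis
      using le_less_trans [OF HR_map_norm [OF that]] unfolding HR_norm_sel HR_sel(3) by blast
  qed
qed (use s_module_HR in \<open>auto simp: s_module_def HR_norm_sel\<close>)

subsection \<open>Extension to all pointed sets\<close>

text \<open>
  \<open>M(E)\<close>, for a set \<open>E\<close> pointed by \<open>b\<close>, is the colimit of \<open>M(F)\<close> over the finite pointed subsets
  \<open>F\<close> of \<open>E\<close>. A triple \<open>(k, f, m)\<close> with \<open>f : k\<^sub>+ \<rightarrow> E\<close> pointed and \<open>m \<in> M(k\<^sub>+)\<close> stands for the
  image of \<open>m\<close> under \<open>M(k\<^sub>+) \<rightarrow> M(f(k\<^sub>+)) \<rightarrow> M(E)\<close>. Two triples are identified iff there is a finite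
  pointed subset \<open>F\<close>, given by a bijection \<open>h : n\<^sub>+ \<cong> F\<close>, through which both maps factor and in
  which the two images agree.
\<close>

definition ext_rep :: "'m smod \<Rightarrow> 'e set \<Rightarrow> 'e \<Rightarrow> (nat \<times> (nat \<Rightarrow> 'e) \<times> 'm) set" where
  "ext_rep M E b = {(k, f, m). f 0 = b \<and> f ` {..k} \<subseteq> E \<and> m \<in> sm_set M k}"

definition ext_rel ::
  "'m smod \<Rightarrow> 'e set \<Rightarrow> 'e \<Rightarrow> ((nat \<times> (nat \<Rightarrow> 'e) \<times> 'm) \<times> (nat \<times> (nat \<Rightarrow> 'e) \<times> 'm)) set" where
  "ext_rel M E b = {((k, f, m), (l, g, m')).
     (k, f, m) \<in> ext_rep M E b \<and> (l, g, m') \<in> ext_rep M E b \<and>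
     (\<exists>n h. inj_on h {..n} \<and> h 0 = b \<and> h ` {..n} \<subseteq> E \<and>
       (\<exists>u\<in>gamma_map k n. \<exists>v\<in>gamma_map l n.
          (\<forall>i\<le>k. f i = h (u i)) \<and> (\<forall>i\<le>l. g i = h (v i)) \<and>
          sm_map M k n u m = sm_map M l n v m'))}"

type_synonym ('e, 'm) ext = "(nat \<times> (nat \<Rightarrow> 'e) \<times> 'm) set"

definition ext_set :: "'m smod \<Rightarrow> 'e set \<Rightarrow> 'e \<Rightarrow> ('e, 'm) ext set" where
  "ext_set M E b = ext_rep M E b // ext_rel M E b"

definition ext_pt :: "'m smod \<Rightarrow> 'e set \<Rightarrow> 'e \<Rightarrow> ('e, 'm) ext" where
  "ext_pt M E b = ext_rel M E b `` {(0, \<lambda>_. b, sm_pt M 0)}"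

text \<open>A map between quotients is given by its effect on representatives: the value on a class is the
  union of the classes (all equal) of the images of its elements. \<open>E'\<close>, \<open>b'\<close> are the target of \<open>u\<close>.\<close>

definition ext_map :: "'m smod \<Rightarrow> 'e' set \<Rightarrow> 'e' \<Rightarrow> ('e \<Rightarrow> 'e') \<Rightarrow> ('e, 'm) ext \<Rightarrow> ('e', 'm) ext" where
  "ext_map M E' b' u c = (\<Union>(k, f, m)\<in>c. ext_rel M E' b' `` {(k, u \<circ> f, m)})"

text \<open>The effect at \<open>E\<close> of a natural transformation \<open>t\<close> with target \<open>N\<close>.\<close>

definition ext_trans :: "'n smod \<Rightarrow> 'e set \<Rightarrow> 'e \<Rightarrow> (nat \<Rightarrow> 'm \<Rightarrow> 'n) \<Rightarrow> ('e, 'm) ext \<Rightarrow> ('e, 'n) ext"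
  where "ext_trans N E b t c = (\<Union>(k, f, m)\<in>c. ext_rel N E b `` {(k, f, t k m)})"


section \<open>Pointed simplicial sets\<close>

text \<open>\<open>ss_map X p q \<theta> : X\<^sub>q \<rightarrow> X\<^sub>p\<close> is the action of a monotone map \<open>\<theta> : [p] \<rightarrow> [q]\<close>.\<close>

record 'a psset =
  ss_set :: "nat \<Rightarrow> 'a set"
  ss_pt :: "nat \<Rightarrow> 'a"
  ss_map :: "nat \<Rightarrow> nat \<Rightarrow> (nat \<Rightarrow> nat) \<Rightarrow> 'a \<Rightarrow> 'a"

definition coface :: "nat \<Rightarrow> nat \<Rightarrow> nat" where
  "coface j i = (if i < j then i else Suc i)"

definition ss_face :: "'a psset \<Rightarrow> nat \<Rightarrow> nat \<Rightarrow> 'a \<Rightarrow> 'a" where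
  "ss_face X q j = ss_map X (q - 1) q (coface j)"

text \<open>The smash product with \<open>k\<^sub>+\<close>. The points of \<open>X \<and> k\<^sub>+\<close> other than the base point are the pairs
  \<open>(x, i)\<close> with \<open>x \<noteq> *\<close>, \<open>i \<noteq> 0\<close>; all other pairs are replaced by the base point \<open>(*, 0)\<close>.\<close>

definition smash_pair :: "'a \<Rightarrow> 'a \<times> nat \<Rightarrow> 'a \<times> nat" where
  "smash_pair b = (\<lambda>(x, i). if x = b \<or> i = 0 then (b, 0) else (x, i))"

definition smash :: "'a psset \<Rightarrow> nat \<Rightarrow> ('a \<times> nat) psset" where
  "smash X k =
     \<lparr>ss_set = (\<lambda>q. smash_pair (ss_pt X q) ` (ss_set X q \<times> {..k})),
      ss_pt = (\<lambda>q. (ss_pt X q, 0)),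
      ss_map = (\<lambda>p q \<theta> (x, i). smash_pair (ss_pt X p) (ss_map X p q \<theta> x, i))\<rparr>"

text \<open>\<open>smod_comp M X\<close> is \<open>M \<circ> X\<close>.\<close>

definition smod_comp :: "'m smod \<Rightarrow> 'a psset \<Rightarrow> ('a, 'm) ext psset" where
  "smod_comp M X =
     \<lparr>ss_set = (\<lambda>q. ext_set M (ss_set X q) (ss_pt X q)),
      ss_pt = (\<lambda>q. ext_pt M (ss_set X q) (ss_pt X q)),
      ss_map = (\<lambda>p q \<theta>. ext_map M (ss_set X p) (ss_pt X p) (ss_map X p q \<theta>))\<rparr>"

text \<open>An element of \<open>X\<^sub>0\<close> has no faces, so the conditions \<open>\<partial>\<^sub>j x = *\<close> are void for \<open>n = 0\<close>.\<close>

definition comb_Z :: "nat \<Rightarrow> 'a psset \<Rightarrow> 'a set" where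
  "comb_Z n Y = {x \<in> ss_set Y n. n \<noteq> 0 \<longrightarrow> (\<forall>j\<le>n. ss_face Y n j x = ss_pt Y (n - 1))}"

definition comb_R :: "nat \<Rightarrow> 'a psset \<Rightarrow> ('a \<times> 'a) set" where
  "comb_R n Y = {(x, y). x \<in> comb_Z n Y \<and> y \<in> comb_Z n Y \<and>
     (\<exists>z\<in>ss_set Y (Suc n). (\<forall>j<n. ss_face Y (Suc n) j z = ss_pt Y n) \<and>
        ss_face Y (Suc n) n z = x \<and> ss_face Y (Suc n) (Suc n) z = y)}"

definition comb_rel :: "nat \<Rightarrow> 'a psset \<Rightarrow> ('a \<times> 'a) set" where
  "comb_rel n Y = (comb_R n Y \<union> (comb_R n Y)\<inverse>)\<^sup>*"

definition pi_comb :: "nat \<Rightarrow> 'a psset \<Rightarrow> 'a set set" where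
  "pi_comb n Y = comb_Z n Y // comb_rel n Y"

text \<open>The map on \<open>\<pi>\<^sub>n\<close> induced by a map of pointed simplicial sets with target \<open>Y\<close> that is \<open>g\<close> in
  degree \<open>n\<close>.\<close>

definition pi_map :: "nat \<Rightarrow> 'b psset \<Rightarrow> ('a \<Rightarrow> 'b) \<Rightarrow> 'a set \<Rightarrow> 'b set" where
  "pi_map n Y g c = (\<Union>x\<in>c. comb_rel n Y `` {g x})"


section \<open>Homology with coefficients in an s-module\<close>

definition smod_homology ::
  "nat \<Rightarrow> 'a psset \<Rightarrow> 'm smod \<Rightarrow> ('a \<times> nat, 'm) ext set smod" where
  "smod_homology n X M =
     \<lparr>sm_set = (\<lambda>k. pi_comb n (smod_comp M (smash X k))),
      sm_pt = (\<lambda>k. comb_rel n (smod_comp M (smash X k)) `` {ss_pt (smod_comp M (smash X k)) n}),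
      sm_map = (\<lambda>k l f. pi_map n (smod_comp M (smash X l))
         (ext_map M (ss_set (smash X l) n) (ss_pt (smash X l) n)
            (\<lambda>(x, i). smash_pair (ss_pt X n) (x, f i))))\<rparr>"

text \<open>The map \<open>H\<^sub>n(X, M) \<rightarrow> H\<^sub>n(X, N)\<close> at \<open>k\<^sub>+\<close> induced by a natural transformation \<open>t : M \<rightarrow> N\<close>.\<close>

definition smod_homology_trans ::
  "nat \<Rightarrow> 'a psset \<Rightarrow> 'n smod \<Rightarrow> (nat \<Rightarrow> 'm \<Rightarrow> 'n) \<Rightarrow> nat
     \<Rightarrow> ('a \<times> nat, 'm) ext set \<Rightarrow> ('a \<times> nat, 'n) ext set" where
  "smod_homology_trans n X N t k =
     pi_map n (smod_comp N (smash X k))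
       (ext_trans N (ss_set (smash X k) n) (ss_pt (smash X k) n) t)"

text \<open>The singular simplicial set with a disjoint base point \<open>None\<close>.\<close>

definition simplex_pullback ::
  "nat \<Rightarrow> nat \<Rightarrow> (nat \<Rightarrow> nat) \<Rightarrow> ((nat \<Rightarrow> real) \<Rightarrow> 'a) \<Rightarrow> (nat \<Rightarrow> real) \<Rightarrow> 'a" where
  "simplex_pullback p q \<theta> \<sigma> =
     restrict (\<lambda>t. \<sigma> (\<lambda>j. \<Sum>i | i \<le> p \<and> \<theta> i = j. t i)) (standard_simplex p)"

definition sing :: "'a topology \<Rightarrow> ((nat \<Rightarrow> real) \<Rightarrow> 'a) option psset" where
  "sing X =
     \<lparr>ss_set = (\<lambda>q. insert None (Some ` singular_simplex_set q X)),
      ss_pt = (\<lambda>q. None),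
      ss_map = (\<lambda>p q \<theta>. map_option (simplex_pullback p q \<theta>))\<rparr>"


section \<open>Singular homology with real coefficients\<close>

type_synonym 'a rchain = "((nat \<Rightarrow> real) \<Rightarrow> 'a) \<Rightarrow>\<^sub>0 real"

definition rchain :: "nat \<Rightarrow> 'a topology \<Rightarrow> 'a rchain \<Rightarrow> bool" where
  "rchain p X c \<longleftrightarrow> Poly_Mapping.keys c \<subseteq> singular_simplex_set p X"

definition rboundary :: "nat \<Rightarrow> 'a rchain \<Rightarrow> 'a rchain" where
  "rboundary p c = (if p = 0 then 0 else
     (\<Sum>\<sigma>\<in>Poly_Mapping.keys c. \<Sum>j\<le>p.
        Poly_Mapping.single (singular_face p j \<sigma>) ((-1) ^ j * Poly_Mapping.lookup c \<sigma>)))"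

definition rcycle_set :: "nat \<Rightarrow> 'a topology \<Rightarrow> 'a rchain set" where
  "rcycle_set p X = {c. rchain p X c \<and> rboundary p c = 0}"

text \<open>Homologous relative to \<open>S\<close>, as in \<^const>\<open>homologous_rel\<close>.\<close>

definition rhomologous_rel :: "nat \<Rightarrow> 'a topology \<Rightarrow> 'a set \<Rightarrow> 'a rchain \<Rightarrow> 'a rchain \<Rightarrow> bool" where
  "rhomologous_rel p X S c d \<longleftrightarrow>
     (\<exists>e. rchain (Suc p) X e \<and> rchain p (subtopology X S) (rboundary (Suc p) e - (c - d)))"

definition rhomology_class :: "nat \<Rightarrow> 'a topology \<Rightarrow> 'a rchain \<Rightarrow> 'a rchain set" where
  "rhomology_class p X c = {d \<in> rcycle_set p X. rhomologous_rel p X {} c d}"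

definition rhomology :: "nat \<Rightarrow> 'a topology \<Rightarrow> 'a rchain set set" where
  "rhomology p X = rhomology_class p X ` rcycle_set p X"

definition l1_norm :: "'a rchain \<Rightarrow> real" where
  "l1_norm c = (\<Sum>\<sigma>\<in>Poly_Mapping.keys c. \<bar>Poly_Mapping.lookup c \<sigma>\<bar>)"

definition gromov_norm :: "nat \<Rightarrow> 'a topology \<Rightarrow> 'a rchain set \<Rightarrow> real" where
  "gromov_norm p X \<alpha> = Inf (l1_norm ` {c \<in> rcycle_set p X. rhomology_class p X c = \<alpha>})"


section \<open>The canonical map\<close>

text \<open>The chain of an element \<open>(k, f, m)\<close> of \<open>H\<real>(sin X \<and> 1\<^sub>+)\<close> is \<open>\<Sum>\<^sub>i m\<^sub>i f(i)\<close>, with the base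
  point counted as zero; it does not depend on the representative.\<close>

definition ext_chain :: "(((nat \<Rightarrow> real) \<Rightarrow> 'a) option \<times> nat, nat \<Rightarrow> real) ext \<Rightarrow> 'a rchain" where
  "ext_chain x = the_elem ((\<lambda>(k, f, m). \<Sum>i=1..k.
     (case f i of (None, _) \<Rightarrow> 0 | (Some \<sigma>, _) \<Rightarrow> Poly_Mapping.single \<sigma> (m i))) ` x)"

text \<open>The identification \<open>H\<^sub>n(X, H\<real>)(1\<^sub>+) = H\<^sub>n(X, \<real>)\<close>.\<close>

definition HR_homology_ident ::
  "nat \<Rightarrow> 'a topology \<Rightarrow> (((nat \<Rightarrow> real) \<Rightarrow> 'a) option \<times> nat, nat \<Rightarrow> real) ext set \<Rightarrow> 'a rchain set"
  where "HR_homology_ident n X c = (\<Union>x\<in>c. rhomology_class n X (ext_chain x))"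

definition canonical_map ::
  "nat \<Rightarrow> 'a topology \<Rightarrow> (((nat \<Rightarrow> real) \<Rightarrow> 'a) option \<times> nat, nat \<Rightarrow> real) ext set \<Rightarrow> 'a rchain set"
  where "canonical_map n X =
     HR_homology_ident n X \<circ> smod_homology_trans n (sing X) HR (\<lambda>k m. m) 1"


section \<open>Riemann surfaces and their fundamental class\<close>

definition riemann_surface :: "'a topology \<Rightarrow> ('a set \<times> ('a \<Rightarrow> complex)) set \<Rightarrow> bool" where
  "riemann_surface X A \<longleftrightarrow>
     topspace X \<noteq> {} \<and> connected_space X \<and> Hausdorff_space X \<and>
     (\<Union>(U, \<phi>)\<in>A. U) = topspace X \<and>
     (\<forall>(U, \<phi>)\<in>A. openin X U \<and> open (\<phi> ` U) \<and>
        homeomorphic_map (subtopology X U) (top_of_set (\<phi> ` U)) \<phi>) \<and>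
     (\<forall>(U, \<phi>)\<in>A. \<forall>(V, \<psi>)\<in>A. (\<psi> \<circ> inv_into U \<phi>) holomorphic_on \<phi> ` (U \<inter> V))"

text \<open>The singular 2-simplex obtained by pulling back under the chart \<open>(U, \<phi>)\<close> the affine triangle
  with centre \<open>z\<close> and counterclockwise vertices \<open>z + r \<omega>\<^sup>j\<close>, where \<open>\<omega> = exp(2\<pi>i/3)\<close>. When \<open>\<phi> x = z\<close>,
  its class generates \<open>H\<^sub>2(X, X - {x})\<close> and is the local complex orientation at \<open>x\<close>.\<close>

definition chart_triangle ::
  "'a set \<Rightarrow> ('a \<Rightarrow> complex) \<Rightarrow> complex \<Rightarrow> real \<Rightarrow> (nat \<Rightarrow> real) \<Rightarrow> 'a" where
  "chart_triangle U \<phi> z r = restrict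
     (\<lambda>t. inv_into U \<phi> (z + of_real r * (\<Sum>j\<le>2. of_real (t j) * cis (2 * pi / 3) ^ j)))
     (standard_simplex 2)"

text \<open>\<open>\<alpha> \<in> H\<^sub>2(X, \<real>)\<close> is the fundamental class iff for every point \<open>x\<close> its image in
  \<open>H\<^sub>2(X, X - {x}; \<real>)\<close> is the local complex orientation at \<open>x\<close>.\<close>

definition fundamental_class ::
  "'a topology \<Rightarrow> ('a set \<times> ('a \<Rightarrow> complex)) set \<Rightarrow> 'a rchain set \<Rightarrow> bool" where
  "fundamental_class X A \<alpha> \<longleftrightarrow> \<alpha> \<in> rhomology 2 X \<and>
     (\<forall>c\<in>\<alpha>. \<forall>(U, \<phi>)\<in>A. \<forall>x\<in>U. \<forall>r>0. cball (\<phi> x) r \<subseteq> \<phi> ` U \<longrightarrow>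
        rhomologous_rel 2 X (topspace X - {x}) c
          (Poly_Mapping.single (chart_triangle U \<phi> (\<phi> x) r) 1))"

end

theory Submission
  imports Defs
begin

text \<open>A class in the range is represented by a chain of norm \<open>< \<lambda>\<close> whose faces vanish separately, so the
  point is to replace a cycle \<open>c\<close> of norm \<open>< \<lambda>\<close>, for which only the alternating sum of the faces vanishes,
  by a homologous chain of no larger norm all of whose faces vanish. Averaging \<open>sgn(\<pi>) \<pi>\<^sup>*c\<close> over the
  permutations \<open>\<pi>\<close> of the vertices does this: the \<open>\<ell>\<^sup>1\<close>-norm does not increase, and the faces of the
  antisymmetrized chain agree up to sign, so each of them is a multiple of its boundary.\<close>

section \<open>Finitely supported real functions\<close>

text \<open>The norm bound constrains only the cycle that represents the class. Homologies are taken
  in ordinary real chains, so the 3-chain joining a cycle to its antisymmetrization may have any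
  norm, and an explicit filling with rational coefficients suffices. The strict bound in
  \<open>HR_norm lam\<close> matches the strict inequality of the theorem, because the infimum of a
  nonempty set bounded below is less than \<open>lam\<close> exactly when some member is. The other
  obstacle is that elements of the composite with the singular set are classes of triples in a
  filtered colimit. They have to be recognized as chains: \<open>ext_chain\<close> is injective,
  turns simplicial faces into faces of chains, and on \<open>HR_norm lam\<close> has as image the
  chains of norm below \<open>lam\<close>. After that, every condition on combinatorial homotopy
  classes is a linear condition on chains.\<close>

abbreviation rscale :: "real \<Rightarrow> ('b \<Rightarrow>\<^sub>0 real) \<Rightarrow> ('b \<Rightarrow>\<^sub>0 real)" where
  "rscale a \<equiv> Poly_Mapping.map ((*) a)"

lemma lookup_scale [simp]: "Poly_Mapping.lookup (rscale a c) x = a * Poly_Mapping.lookup c x"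
  by (simp add: Poly_Mapping.map.rep_eq when_def)

lemma scale_zero [simp]: "rscale a 0 = 0"
  by (rule poly_mapping_eqI) simp

lemma keys_scale: "Poly_Mapping.keys (rscale a c) \<subseteq> Poly_Mapping.keys c"
  by (auto simp: in_keys_iff)

text \<open>The pushforward of a finitely supported signed measure. For a face or a pullback map
  \<open>g\<close> it is the induced map on chains.\<close>

definition push :: "('b \<Rightarrow> 'c) \<Rightarrow> ('b \<Rightarrow>\<^sub>0 real) \<Rightarrow> ('c \<Rightarrow>\<^sub>0 real)" where
  "push g c = (\<Sum>x\<in>Poly_Mapping.keys c. Poly_Mapping.single (g x) (Poly_Mapping.lookup c x))"

text \<open>The index set \<open>K\<close> is allowed to exceed the support so that chains with
  different supports can be compared over one common finite set.\<close>

lemma lookup_push_superset: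
  assumes "finite K" "Poly_Mapping.keys c \<subseteq> K"
  shows "Poly_Mapping.lookup (push g c) y = (\<Sum>x | x \<in> K \<and> g x = y. Poly_Mapping.lookup c x)"
proof -
  have "Poly_Mapping.lookup (push g c) y
      = (\<Sum>x\<in>Poly_Mapping.keys c. if g x = y then Poly_Mapping.lookup c x else 0)"
    by (simp add: push_def lookup_sum lookup_single when_def)
  also have "\<dots> = (\<Sum>x\<in>K. if g x = y then Poly_Mapping.lookup c x else 0)"
    using assms by (intro sum.mono_neutral_left) (auto simp: in_keys_iff)
  also have "\<dots> = (\<Sum>x | x \<in> K \<and> g x = y. Poly_Mapping.lookup c x)"
    using assms(1) by (simp add: sum.inter_filter)
  finally show ?thesis .
qed

lemma push_eq_superset:
  assumes "finite K" "Poly_Mapping.keys c \<subseteq> K"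
  shows "push g c = (\<Sum>x\<in>K. Poly_Mapping.single (g x) (Poly_Mapping.lookup c x))"
  unfolding push_def using assms
  by (intro sum.mono_neutral_left) (auto simp: in_keys_iff)

lemma push_zero [simp]: "push g 0 = 0"
  by (simp add: push_def)

lemma push_add: "push g (c + d) = push g c + push g d"
proof -
  let ?K = "Poly_Mapping.keys c \<union> Poly_Mapping.keys d"
  have "Poly_Mapping.keys (c + d) \<subseteq> ?K" by (rule Poly_Mapping.keys_add)
  then show ?thesis
    by (simp add: push_eq_superset [of ?K] lookup_add single_add sum.distrib)
qed

lemma push_scale: "push g (rscale a c) = rscale a (push g c)"
proof (rule poly_mapping_eqI)
  fix y
  show "Poly_Mapping.lookup (push g (rscale a c)) y = Poly_Mapping.lookup (rscale a (push g c)) y"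
    using keys_scale [of a c]
    by (simp add: lookup_push_superset [of "Poly_Mapping.keys c"] sum_distrib_left)
qed

lemma scale_minus_one: "rscale (-1) c = - c"
  by (rule poly_mapping_eqI) simp

lemma push_diff: "push g (c - d) = push g c - push g d"
  using push_add [of g c "- d"] push_scale [of g "-1" d] by (simp add: scale_minus_one)

lemma push_sum: "push g (sum f I) = (\<Sum>i\<in>I. push g (f i))"
  by (induction I rule: infinite_finite_induct) (simp_all add: push_add)

lemma push_single: "push g (Poly_Mapping.single x a) = Poly_Mapping.single (g x) a"
  by (simp add: push_def)

lemma push_push: "push g (push h c) = push (g \<circ> h) c"
  by (subst (2) push_def) (simp add: push_sum push_single, simp add: push_def)

lemma push_id: "(\<And>x. x \<in> Poly_Mapping.keys c \<Longrightarrow> g x = x) \<Longrightarrow> push g c = c"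
proof (rule poly_mapping_eqI)
  fix y
  assume g: "\<And>x. x \<in> Poly_Mapping.keys c \<Longrightarrow> g x = x"
  have "{x. x \<in> Poly_Mapping.keys c \<and> g x = y} = (if y \<in> Poly_Mapping.keys c then {y} else {})"
    using g by auto
  then show "Poly_Mapping.lookup (push g c) y = Poly_Mapping.lookup c y"
    by (simp add: lookup_push_superset [of "Poly_Mapping.keys c"] in_keys_iff)
qed

lemma keys_push: "Poly_Mapping.keys (push g c) \<subseteq> g ` Poly_Mapping.keys c"
proof
  fix y assume "y \<in> Poly_Mapping.keys (push g c)"
  then have "(\<Sum>x | x \<in> Poly_Mapping.keys c \<and> g x = y. Poly_Mapping.lookup c x) \<noteq> 0"
    by (simp add: in_keys_iff lookup_push_superset [of "Poly_Mapping.keys c"])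
  then show "y \<in> g ` Poly_Mapping.keys c"
    by (metis (mono_tags, lifting) image_eqI mem_Collect_eq sum.neutral)
qed

section \<open>The norm of chains and its behaviour under pushforward\<close>

lemma l1_norm_superset:
  assumes "finite K" "Poly_Mapping.keys c \<subseteq> K"
  shows "l1_norm c = (\<Sum>x\<in>K. \<bar>Poly_Mapping.lookup c x\<bar>)"
  unfolding l1_norm_def using assms by (intro sum.mono_neutral_left) (auto simp: in_keys_iff)

lemma l1_norm_nonneg: "0 \<le> l1_norm c"
  by (simp add: l1_norm_def sum_nonneg)

lemma l1_norm_add: "l1_norm (c + d) \<le> l1_norm c + l1_norm d"
proof -
  let ?K = "Poly_Mapping.keys c \<union> Poly_Mapping.keys d"
  have "Poly_Mapping.keys (c + d) \<subseteq> ?K" by (rule Poly_Mapping.keys_add)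
  then show ?thesis
    by (simp add: l1_norm_superset [of ?K] lookup_add abs_triangle_ineq sum_mono flip: sum.distrib)
qed

lemma l1_norm_scale: "l1_norm (rscale a c) = \<bar>a\<bar> * l1_norm c"
  using keys_scale [of a c]
  by (simp add: l1_norm_superset [of "Poly_Mapping.keys c"] abs_mult sum_distrib_left)

lemma l1_norm_diff: "l1_norm (c - d) \<le> l1_norm c + l1_norm d"
  using l1_norm_add [of c "rscale (-1) d"] l1_norm_scale [of "-1" d] by (simp add: scale_minus_one)

lemma l1_norm_single [simp]: "l1_norm (Poly_Mapping.single x a) = \<bar>a\<bar>"
  by (simp add: l1_norm_def)

lemma l1_norm_sum: "l1_norm (sum f I) \<le> (\<Sum>i\<in>I. l1_norm (f i))"
proof (induction I rule: infinite_finite_induct)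
  case (insert i I)
  then show ?case using l1_norm_add [of "f i" "sum f I"] by simp
qed (simp_all add: l1_norm_def)

text \<open>Coefficients of points with the same image are added and may cancel, but mass is never
  created.\<close>

lemma l1_norm_push: "l1_norm (push g c) \<le> l1_norm c"
  using l1_norm_sum [of "\<lambda>x. Poly_Mapping.single (g x) (Poly_Mapping.lookup c x)" "Poly_Mapping.keys c"]
  by (simp add: push_def l1_norm_def [of c])

section \<open>Pullbacks of singular simplices along maps of vertices\<close>

text \<open>In barycentric coordinates this is the affine map of simplices that sends vertex
  \<open>i\<close> to vertex \<open>\<theta> i\<close>. Monotonicity of \<open>\<theta>\<close> is
  not imposed, so that permutations of the vertices are covered.\<close>

abbreviation affine_pull :: "nat \<Rightarrow> (nat \<Rightarrow> nat) \<Rightarrow> (nat \<Rightarrow> real) \<Rightarrow> nat \<Rightarrow> real" where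
  "affine_pull p \<theta> t \<equiv> \<lambda>j. \<Sum>i | i \<le> p \<and> \<theta> i = j. t i"

lemma affine_pull_in_standard_simplex:
  assumes "\<theta> ` {..p} \<subseteq> {..q}" "t \<in> standard_simplex p"
  shows "affine_pull p \<theta> t \<in> standard_simplex q"
proof -
  have t: "\<And>i. 0 \<le> t i" "(\<Sum>i\<le>p. t i) = 1"
    using assms(2) by (auto simp: standard_simplex_def)
  have "(\<Sum>j\<le>q. affine_pull p \<theta> t j) = (\<Sum>j\<le>q. \<Sum>i | i \<in> {..p} \<and> \<theta> i = j. t i)"
    by simp
  also have "\<dots> = (\<Sum>i\<le>p. t i)"
    by (rule sum.group) (use assms in auto)
  finally have "(\<Sum>j\<le>q. affine_pull p \<theta> t j) = 1" using t by simp
  moreover have "affine_pull p \<theta> t j \<le> (\<Sum>i\<le>p. t i)" for j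
    by (rule sum_mono2) (use t in auto)
  moreover have "affine_pull p \<theta> t j = 0" if "j > q" for j
    by (rule sum.neutral) (use assms(1) that in fastforce)
  moreover have "0 \<le> affine_pull p \<theta> t j" for j
    by (rule sum_nonneg) (use t in auto)
  ultimately show ?thesis
    using t(2) unfolding standard_simplex_def by simp
qed

lemma continuous_map_affine_pull:
  assumes "\<theta> ` {..p} \<subseteq> {..q}"
  shows "continuous_map (subtopology (powertop_real UNIV) (standard_simplex p))
           (subtopology (powertop_real UNIV) (standard_simplex q)) (affine_pull p \<theta>)"
  unfolding continuous_map_in_subtopology continuous_map_componentwise_UNIV
proof (intro conjI allI)
  show "continuous_map (subtopology (powertop_real UNIV) (standard_simplex p)) euclideanreal
          (\<lambda>t. affine_pull p \<theta> t j)" for j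
    by (intro continuous_map_sum continuous_map_from_subtopology continuous_map_product_projection)
      simp_all
qed (use affine_pull_in_standard_simplex [OF assms] in auto)

lemma simplex_pullback_eq:
  "simplex_pullback p q \<theta> \<sigma> = restrict (\<sigma> \<circ> affine_pull p \<theta>) (standard_simplex p)"
  by (simp add: simplex_pullback_def restrict_def fun_eq_iff)

lemma singular_simplex_pullback:
  assumes "\<theta> ` {..p} \<subseteq> {..q}" "singular_simplex q X \<sigma>"
  shows "singular_simplex p X (simplex_pullback p q \<theta> \<sigma>)"
proof -
  let ?T = "\<lambda>p. subtopology (powertop_real UNIV) (standard_simplex p)"
  have "continuous_map (?T p) X (\<sigma> \<circ> affine_pull p \<theta>)"
    using continuous_map_affine_pull [OF assms(1)] assms(2) [unfolded singular_simplex_def]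
    by (blast intro: continuous_map_compose)
  then have "continuous_map (?T p) X (restrict (\<sigma> \<circ> affine_pull p \<theta>) (standard_simplex p))"
    by (rule continuous_map_eq) simp
  then show ?thesis
    by (simp add: singular_simplex_def simplex_pullback_eq)
qed

lemma simplex_pullback_cong:
  "(\<And>i. i \<le> p \<Longrightarrow> \<theta> i = \<eta> i) \<Longrightarrow> simplex_pullback p q \<theta> = simplex_pullback p q \<eta>"
proof -
  assume "\<And>i. i \<le> p \<Longrightarrow> \<theta> i = \<eta> i"
  then have "{i. i \<le> p \<and> \<theta> i = j} = {i. i \<le> p \<and> \<eta> i = j}" for j by auto
  then show ?thesis by (simp add: simplex_pullback_def fun_eq_iff)
qed

text \<open>Each fibre of the composite is split according to the value of \<open>\<theta>\<close>.
  The image bound makes this splitting exhaustive and keeps the inner argument inside the simplex on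
  which the restricted function is meaningful.\<close>

lemma simplex_pullback_comp:
  assumes "\<theta> ` {..p} \<subseteq> {..q}"
  shows "simplex_pullback p q \<theta> (simplex_pullback q r \<eta> \<sigma>) = simplex_pullback p r (\<eta> \<circ> \<theta>) \<sigma>"
proof
  fix t
  show "simplex_pullback p q \<theta> (simplex_pullback q r \<eta> \<sigma>) t = simplex_pullback p r (\<eta> \<circ> \<theta>) \<sigma> t"
  proof (cases "t \<in> standard_simplex p")
    case True
    have "affine_pull q \<eta> (affine_pull p \<theta> t) j = affine_pull p (\<eta> \<circ> \<theta>) t j" for j
    proof -
      have "affine_pull q \<eta> (affine_pull p \<theta> t) j
          = (\<Sum>l | l \<le> q \<and> \<eta> l = j. \<Sum>i | i \<in> {i. i \<le> p \<and> \<eta> (\<theta> i) = j} \<and> \<theta> i = l. t i)"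
        by (intro sum.cong) auto
      also have "\<dots> = (\<Sum>i | i \<le> p \<and> \<eta> (\<theta> i) = j. t i)"
        by (rule sum.group) (use assms in auto)
      finally show ?thesis by simp
    qed
    then show ?thesis
      using True affine_pull_in_standard_simplex [OF assms True] by (simp add: simplex_pullback_eq)
  qed (simp add: simplex_pullback_def)
qed

lemma simplex_pullback_id:
  assumes "singular_simplex p X \<sigma>" "\<And>i. i \<le> p \<Longrightarrow> \<theta> i = i"
  shows "simplex_pullback p p \<theta> \<sigma> = \<sigma>"
proof
  fix t
  have "affine_pull p \<theta> t = t" if "t \<in> standard_simplex p"
  proof
    fix j
    have "{i. i \<le> p \<and> \<theta> i = j} = (if j \<le> p then {j} else {})"
      using assms(2) by auto
    then show "affine_pull p \<theta> t j = t j"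
      using that by (simp add: standard_simplex_def)
  qed
  then show "simplex_pullback p p \<theta> \<sigma> t = \<sigma> t"
    using assms(1) by (auto simp: simplex_pullback_eq singular_simplex_def extensional_def)
qed

text \<open>Identifies the library's face operator with the face of the simplicial set, so that
  faces and permutations of vertices are composed by the same rule.\<close>

lemma singular_face_eq_pullback:
  assumes "p > 0" "j \<le> p"
  shows "(singular_face p j :: ((nat \<Rightarrow> real) \<Rightarrow> 'a) \<Rightarrow> _) = simplex_pullback (p - 1) p (coface j)"
proof -
  have "simplical_face j t = affine_pull (p - 1) (coface j) t" if "t \<in> standard_simplex (p - 1)" for t
  proof
    fix l
    have "{i. i \<le> p - 1 \<and> coface j i = l} =
        (if l < j then {l} else if l = j \<or> l > p then {} else {l - 1})"
      using assms by (auto simp: coface_def split: if_splits)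
    \<comment> \<open>Beyond index \<open>p\<close> the library's formula reads the coordinate
      \<open>l - 1\<close>, which lies past the last vertex \<open>p - 1\<close> of the
      face.\<close>
    moreover have "t (l - 1) = 0" if "l > p" "p > 0"
      using that \<open>t \<in> _\<close> by (auto simp: standard_simplex_def)
    ultimately show "simplical_face j t l = affine_pull (p - 1) (coface j) t l"
      using assms by (auto simp: simplical_face_def)
  qed
  then have "restrict (\<sigma> \<circ> simplical_face j) (standard_simplex (p - 1))
      = restrict (\<sigma> \<circ> affine_pull (p - 1) (coface j)) (standard_simplex (p - 1))" for \<sigma> :: "_ \<Rightarrow> 'a"
    by (intro restrict_ext) (simp only: comp_apply)
  then show ?thesis
    unfolding singular_face_def simplex_pullback_eq fun_eq_iff by simp
qed

lemma coface_image: "p > 0 \<Longrightarrow> coface j ` {..p - 1} \<subseteq> {..p}"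
  by (auto simp: coface_def)

section \<open>Real chains\<close>

lemma rchain_add: "rchain p X c \<Longrightarrow> rchain p X d \<Longrightarrow> rchain p X (c + d)"
  unfolding rchain_def using Poly_Mapping.keys_add [of c d] by blast

lemma rchain_scale: "rchain p X c \<Longrightarrow> rchain p X (rscale a c)"
  unfolding rchain_def using keys_scale [of a c] by blast

lemma rchain_uminus: "rchain p X c \<Longrightarrow> rchain p X (- c)"
  using rchain_scale [of p X c "-1"] by (simp add: scale_minus_one)

lemma rchain_diff: "rchain p X c \<Longrightarrow> rchain p X d \<Longrightarrow> rchain p X (c - d)"
  using rchain_add [of p X c "- d"] rchain_uminus [of p X d] by simp

lemma rchain_empty: "rchain p (subtopology X {}) c \<longleftrightarrow> c = 0"
  by (auto simp: rchain_def singular_simplex_empty subset_eq poly_mapping_eqI in_keys_iff)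

lemma rchain_push_pullback:
  assumes "\<theta> ` {..p} \<subseteq> {..q}" "rchain q X c"
  shows "rchain p X (push (simplex_pullback p q \<theta>) c)"
  using keys_push [of "simplex_pullback p q \<theta>" c] singular_simplex_pullback [OF assms(1)] assms(2)
  unfolding rchain_def by blast

text \<open>Writes the boundary through the individual faces, the form in which a vanishing boundary
  can be compared with the vanishing of every face.\<close>

lemma rboundary_eq:
  "p > 0 \<Longrightarrow> rboundary p c = (\<Sum>j\<le>p. rscale ((-1) ^ j) (push (singular_face p j) c))"
proof (rule poly_mapping_eqI)
  fix \<tau>
  assume "p > 0"
  then show "Poly_Mapping.lookup (rboundary p c) \<tau>
      = Poly_Mapping.lookup (\<Sum>j\<le>p. rscale ((-1) ^ j) (push (singular_face p j) c)) \<tau>"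
    unfolding rboundary_def push_def
    by (subst sum.swap) (simp add: lookup_sum lookup_single sum_distrib_left mult_when)
qed

lemma rboundary_0 [simp]: "rboundary p 0 = 0"
  by (simp add: rboundary_def)

lemma rboundary_add: "rboundary p (c + d) = rboundary p c + rboundary p d"
proof (cases "p = 0")
  case False
  then show ?thesis
    by (intro poly_mapping_eqI)
      (simp add: rboundary_eq push_add lookup_sum lookup_add distrib_left sum.distrib)
qed (simp add: rboundary_def)

lemma rboundary_scale: "rboundary p (rscale a c) = rscale a (rboundary p c)"
proof (cases "p = 0")
  case False
  then show ?thesis
    by (intro poly_mapping_eqI)
      (simp add: rboundary_eq push_scale lookup_sum sum_distrib_left mult.left_commute)
qed (simp add: rboundary_def)

text \<open>The empty space carries only the zero chain, so the error term of the relative notion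
  disappears.\<close>

lemma rhomologous_empty_iff:
  "rhomologous_rel p X {} c d \<longleftrightarrow> (\<exists>e. rchain (Suc p) X e \<and> rboundary (Suc p) e = c - d)"
  by (simp only: rhomologous_rel_def rchain_empty right_minus_eq)

lemma rhomologous_refl: "rhomologous_rel p X {} c c"
  unfolding rhomologous_empty_iff by (intro exI [of _ 0]) (simp add: rchain_def)

lemma rhomologous_sym: "rhomologous_rel p X {} c d \<Longrightarrow> rhomologous_rel p X {} d c"
  unfolding rhomologous_empty_iff
  by (metis minus_diff_eq rboundary_scale rchain_uminus scale_minus_one)

lemma rhomologous_trans:
  assumes "rhomologous_rel p X {} b c" "rhomologous_rel p X {} c d"
  shows "rhomologous_rel p X {} b d"
proof -
  obtain e f where "rchain (Suc p) X e" "rboundary (Suc p) e = b - c"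
    "rchain (Suc p) X f" "rboundary (Suc p) f = c - d"
    using assms unfolding rhomologous_empty_iff by blast
  then show ?thesis
    unfolding rhomologous_empty_iff by (intro exI [of _ "e + f"]) (simp add: rchain_add rboundary_add)
qed

lemma rhomology_class_eq:
  "rhomologous_rel p X {} c d \<Longrightarrow> rhomology_class p X c = rhomology_class p X d"
  unfolding rhomology_class_def using rhomologous_sym rhomologous_trans by blast

section \<open>Antisymmetrization of 2-cycles\<close>

text \<open>A list \<open>w\<close> of vertices stands for the affine simplex in \<open>\<Delta>\<^sup>q\<close> with these vertices; composing
  with it turns a \<open>q\<close>-chain into a chain of degree \<open>length w - 1\<close>.\<close>

definition vertex_push :: "nat \<Rightarrow> nat list \<Rightarrow> 'a rchain \<Rightarrow> 'a rchain" where
  "vertex_push q w = push (simplex_pullback (length w - 1) q ((!) w))"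

lemma vertex_push_0 [simp]: "vertex_push q w 0 = 0"
  by (simp add: vertex_push_def)

lemma vertex_push_linear:
  "vertex_push q w (c + d) = vertex_push q w c + vertex_push q w d"
  "vertex_push q w (c - d) = vertex_push q w c - vertex_push q w d"
  "vertex_push q w (rscale a c) = rscale a (vertex_push q w c)"
  by (simp_all add: vertex_push_def push_add push_diff push_scale)

text \<open>Composition of affine simplices is lookup of vertices, so identities between induced
  maps reduce to computations with literal lists.\<close>

lemma vertex_push_vertex_push:
  fixes c :: "'a rchain"
  assumes "length w = Suc p" "set v \<subseteq> {..p}" "v \<noteq> []"
  shows "vertex_push p v (vertex_push q w c) = vertex_push q (map ((!) w) v) c"
proof -
  have len: "i < length v" if "i \<le> length v - 1" for i
    using that assms(3) by (cases v) auto
  have "(!) v ` {..length v - 1} \<subseteq> {..p}"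
    using assms(2) len nth_mem by blast
  moreover have "(simplex_pullback (length v - 1) q ((!) w \<circ> (!) v) :: _ \<Rightarrow> _ \<Rightarrow> 'a)
      = simplex_pullback (length v - 1) q ((!) (map ((!) w) v))"
    by (intro simplex_pullback_cong) (simp add: len)
  ultimately show ?thesis
    using assms(1) by (simp add: vertex_push_def push_push comp_def simplex_pullback_comp)
qed

text \<open>The coface skips index \<open>j\<close>, hence the face drops the \<open>j\<close>-th
  vertex from the list.\<close>

lemma face_vertex_push:
  fixes c :: "'a rchain"
  assumes "length w = Suc p" "p > 0" "j \<le> p"
  shows "push (singular_face p j) (vertex_push q w c) = vertex_push q (take j w @ drop (Suc j) w) c"
proof -
  have "(simplex_pullback (p - 1) q ((!) w \<circ> coface j) :: _ \<Rightarrow> _ \<Rightarrow> 'a)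
      = simplex_pullback (p - 1) q ((!) (take j w @ drop (Suc j) w))"
    using assms by (intro simplex_pullback_cong) (auto simp: coface_def nth_append)
  moreover have "length (take j w @ drop (Suc j) w) - 1 = p - 1"
    using assms by simp
  ultimately show ?thesis
    using assms coface_image [of p]
    by (simp add: vertex_push_def push_push comp_def [of "simplex_pullback _ _ _"]
        singular_face_eq_pullback simplex_pullback_comp)
qed

lemma rchain_vertex_push:
  assumes "length w = Suc p" "set w \<subseteq> {..q}" "rchain q X c"
  shows "rchain p X (vertex_push q w c)"
proof -
  have "(!) w ` {..p} \<subseteq> set w"
    using assms(1) by (auto simp: less_Suc_eq_le)
  with assms(2) have "(!) w ` {..p} \<subseteq> {..q}" by (rule order_trans [rotated])
  then show ?thesis
    using rchain_push_pullback [of "(!) w" p q X c] assms(1,3) by (simp add: vertex_push_def)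
qed

lemma vertex_push_id:
  assumes "rchain 2 X c"
  shows "vertex_push 2 [0, 1, 2] c = c"
  unfolding vertex_push_def
proof (rule push_id)
  fix \<sigma> assume "\<sigma> \<in> Poly_Mapping.keys c"
  then have "singular_simplex 2 X \<sigma>" using assms by (auto simp: rchain_def)
  moreover have "[0, 1, 2] ! i = i" if "i \<le> 2" for i :: nat
    using that by (auto simp: numeral_2_eq_2 le_Suc_eq)
  ultimately have "simplex_pullback 2 2 ((!) [0, 1, 2]) \<sigma> = \<sigma>"
    by (rule simplex_pullback_id)
  then show "simplex_pullback (length [0::nat, 1, 2] - 1) 2 ((!) [0, 1, 2]) \<sigma> = \<sigma>"
    by (simp add: numeral_2_eq_2)
qed

lemma l1_norm_vertex_push: "l1_norm (vertex_push q w c) \<le> l1_norm c"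
  by (simp add: vertex_push_def l1_norm_push)

text \<open>The first three lists are the even permutations of the vertices, the last three the odd
  ones; \<open>1/6\<close> is the reciprocal of the order of the symmetric group.\<close>

definition antisymmetrization :: "'a rchain \<Rightarrow> 'a rchain" where
  "antisymmetrization c = rscale (1/6)
     (vertex_push 2 [0,1,2] c + vertex_push 2 [1,2,0] c + vertex_push 2 [2,0,1] c
      - vertex_push 2 [1,0,2] c - vertex_push 2 [0,2,1] c - vertex_push 2 [2,1,0] c)"

lemma rchain_antisymmetrization: "rchain 2 X c \<Longrightarrow> rchain 2 X (antisymmetrization c)"
  unfolding antisymmetrization_def
  by (intro rchain_scale rchain_add rchain_diff rchain_vertex_push) auto

lemma l1_norm_antisymmetrization: "l1_norm (antisymmetrization c) \<le> l1_norm c"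
proof -
  let ?v = "\<lambda>w. vertex_push 2 w c"
  have "l1_norm (?v [0,1,2] + ?v [1,2,0] + ?v [2,0,1] - ?v [1,0,2] - ?v [0,2,1] - ?v [2,1,0])
      \<le> l1_norm (?v [0,1,2]) + l1_norm (?v [1,2,0]) + l1_norm (?v [2,0,1])
        + l1_norm (?v [1,0,2]) + l1_norm (?v [0,2,1]) + l1_norm (?v [2,1,0])"
    by (intro order_trans [OF l1_norm_diff] order_trans [OF l1_norm_add] add_mono order_refl)
  also have "\<dots> \<le> 6 * l1_norm c"
    using l1_norm_vertex_push [of 2 _ c] by (smt (verit))
  finally show ?thesis by (simp add: antisymmetrization_def l1_norm_scale)
qed

text \<open>For \<open>v = [0,1]\<close> this is the cycle condition itself. Composing it with any
  affine map into the edge yields further relations, among reversed edges or folded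
  2-simplices.\<close>

lemma cycle_vertex_relation:
  assumes "rchain 2 X c" "rboundary 2 c = 0" "v \<noteq> []" "set v \<subseteq> {..1}"
  shows "vertex_push 2 (map ((!) [1,2]) v) c - vertex_push 2 (map ((!) [0,2]) v) c
       + vertex_push 2 (map ((!) [0,1]) v) c = 0"
proof -
  have "vertex_push 2 [1,2] c - vertex_push 2 [0,2] c + vertex_push 2 [0,1] c
      = rboundary 2 (vertex_push 2 [0,1,2] c)"
    by (rule poly_mapping_eqI)
      (simp add: rboundary_eq face_vertex_push lookup_sum lookup_add lookup_minus
        numeral_2_eq_2 atMost_Suc)
  also have "\<dots> = 0"
    by (simp only: vertex_push_id [OF assms(1)] assms(2))
  finally have "vertex_push 1 v (vertex_push 2 [1,2] c - vertex_push 2 [0,2] c + vertex_push 2 [0,1] c) = 0"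
    by simp
  then show ?thesis
    using assms(3,4) by (simp add: vertex_push_linear vertex_push_vertex_push)
qed


text \<open>In degree 1 antisymmetrization changes an edge by half of \<open>[0,1] + [1,0]\<close>.
  The boundary of \<open>[0,1,0]\<close> is this sum minus \<open>[0,0]\<close>, and
  \<open>[0,0,0]\<close> has boundary \<open>[0,0]\<close>, whence \<open>h\<^sub>1\<close>. In
  degree 2 the chain to be coned is closed because antisymmetrization commutes with boundaries, so
  it is the boundary of its cone.\<close>

lemma antisymmetrization_homologous:
  assumes c: "rchain 2 X c" "rboundary 2 c = 0"
  shows "rhomologous_rel 2 X {} c (antisymmetrization c)"
proof -
  let ?v = "\<lambda>w. vertex_push 2 w c"
  \<comment> \<open>A natural homotopy from the identity to the antisymmetrization is \<open>h\<^sub>0 = 0\<close>,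
    \<open>h\<^sub>1 = ([0,1,0] + [0,0,0]) / 2\<close>, and \<open>h\<^sub>2\<close> the cone with apex 0 over \<open>[0,1,2] - Alt - h\<^sub>1 \<partial>\<close>; the
    chain \<open>e\<close> is \<open>h\<^sub>2 c\<close>.\<close>
  define e where "e = rscale (5/6) (?v [0,0,1,2])
    + rscale (1/6) (?v [0,1,0,2] + ?v [0,0,2,1] + ?v [0,2,1,0] - ?v [0,1,2,0] - ?v [0,2,0,1])
    + rscale (1/2) (?v [0,0,2,0] - ?v [0,0,1,0] - ?v [0,1,2,1] - ?v [0,1,1,1])"
  have "rchain 3 X e"
    unfolding e_def using c(1)
    by (intro rchain_scale rchain_add rchain_diff rchain_vertex_push) auto
  moreover have "rboundary 3 e = ?v [0,1,2] - antisymmetrization c"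
  proof (rule poly_mapping_eqI)
    fix \<tau>
    let ?l = "\<lambda>w. Poly_Mapping.lookup (?v w) \<tau>"
    \<comment> \<open>The boundary of \<open>e\<close> differs from the target by
      \<open>h\<^sub>1\<close> applied to the boundary of \<open>c\<close>, up to sign; these
      relations make it vanish. In the second, the two terms \<open>[0,0,0]\<close> cancel because
      the edges \<open>[0,2]\<close> and \<open>[0,1]\<close> start at the same vertex.\<close>
    have "?v [1,2,1] - ?v [0,2,0] + ?v [0,1,0] = 0" "?v [1,1,1] = 0"
      using cycle_vertex_relation [OF c, of "[0,1,0]"] cycle_vertex_relation [OF c, of "[0,0,0]"]
      by simp_all
    then have "?l [1,2,1] - ?l [0,2,0] + ?l [0,1,0] = 0" "?l [1,1,1] = 0"
      by (simp_all flip: lookup_add lookup_minus)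
    then show "Poly_Mapping.lookup (rboundary 3 e) \<tau> = Poly_Mapping.lookup (?v [0,1,2] - antisymmetrization c) \<tau>"
      by (simp add: rboundary_eq e_def antisymmetrization_def push_add push_diff push_scale face_vertex_push
          lookup_sum lookup_add lookup_minus numeral_3_eq_3 numeral_2_eq_2 atMost_Suc algebra_simps)
  qed
  ultimately show ?thesis
    unfolding rhomologous_empty_iff vertex_push_id [OF c(1)] by (auto simp: numeral_3_eq_3 numeral_2_eq_2)
qed

lemma face_antisymmetrization:
  assumes c: "rchain 2 X c" "rboundary 2 c = 0" and "j \<le> 2"
  shows "push (singular_face 2 j) (antisymmetrization c) = 0"
proof (rule poly_mapping_eqI)
  fix \<tau>
  let ?v = "\<lambda>w. vertex_push 2 w c"
  let ?l = "\<lambda>w. Poly_Mapping.lookup (?v w) \<tau>"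
  \<comment> \<open>The cycle condition and its image under reversal of edges. Faces 0 and 2 are
    \<open>1/6\<close> of the first expression minus the second, and face 1 is the negative of
    that.\<close>
  have "?v [1,2] - ?v [0,2] + ?v [0,1] = 0" "?v [2,1] - ?v [2,0] + ?v [1,0] = 0"
    using cycle_vertex_relation [OF c, of "[0,1]"] cycle_vertex_relation [OF c, of "[1,0]"]
    by simp_all
  then have "?l [1,2] - ?l [0,2] + ?l [0,1] = 0" "?l [2,1] - ?l [2,0] + ?l [1,0] = 0"
    by (metis lookup_zero lookup_add lookup_minus)+
  moreover have "j = 0 \<or> j = 1 \<or> j = 2" using \<open>j \<le> 2\<close> by auto
  ultimately show "Poly_Mapping.lookup (push (singular_face 2 j) (antisymmetrization c)) \<tau>
      = Poly_Mapping.lookup 0 \<tau>"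
    by (elim disjE) (simp_all add: antisymmetrization_def push_add push_diff push_scale face_vertex_push
        lookup_add lookup_minus numeral_2_eq_2)
qed

section \<open>Elements of the s-module as chains\<close>

text \<open>The model of a smash product with \<open>1\<^sub>+\<close>: the tag \<open>Suc 0\<close>
  is the only element of \<open>1\<^sub>+\<close> besides the base point.\<close>

definition pointed :: "'e set \<Rightarrow> ('e option \<times> nat) set" where
  "pointed S = insert (None, 0) ((\<lambda>\<sigma>. (Some \<sigma>, Suc 0)) ` S)"

lemma in_pointed_iff: "y \<in> pointed S \<longleftrightarrow> y = (None, 0) \<or> (\<exists>\<sigma>\<in>S. y = (Some \<sigma>, Suc 0))"
  by (auto simp: pointed_def)

definition rep_chain :: "nat \<times> (nat \<Rightarrow> 'e option \<times> nat) \<times> (nat \<Rightarrow> real) \<Rightarrow> 'e \<Rightarrow>\<^sub>0 real" where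
  "rep_chain = (\<lambda>(k, f, m). \<Sum>i=1..k.
     (case f i of (None, _) \<Rightarrow> 0 | (Some \<sigma>, _) \<Rightarrow> Poly_Mapping.single \<sigma> (m i)))"

lemma ext_chain_eq: "ext_chain x = the_elem (rep_chain ` x)"
  by (simp add: ext_chain_def rep_chain_def)

lemma lookup_rep_chain:
  assumes "f 0 = (None, 0)" "f ` {..k} \<subseteq> pointed S"
  shows "Poly_Mapping.lookup (rep_chain (k, f, m)) \<sigma> = (\<Sum>i | i \<le> k \<and> f i = (Some \<sigma>, Suc 0). m i)"
proof -
  have "Poly_Mapping.lookup (rep_chain (k, f, m)) \<sigma> = (\<Sum>i=1..k. if f i = (Some \<sigma>, Suc 0) then m i else 0)"
    unfolding rep_chain_def case_prod_conv lookup_sum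
  proof (rule sum.cong)
    fix i assume "i \<in> {1..k}"
    then have "f i \<in> pointed S" using assms(2) by auto
    then show "Poly_Mapping.lookup (case f i of (None, _) \<Rightarrow> 0 | (Some \<sigma>, _) \<Rightarrow> Poly_Mapping.single \<sigma> (m i)) \<sigma>
        = (if f i = (Some \<sigma>, Suc 0) then m i else 0)"
      by (auto simp: in_pointed_iff lookup_single when_def)
  qed simp
  also have "\<dots> = (\<Sum>i | i \<in> {1..k} \<and> f i = (Some \<sigma>, Suc 0). m i)"
    by (rule sum.inter_filter [symmetric]) simp
  \<comment> \<open>Index 0 is mapped to the base point, so it can be added to the index set
    freely.\<close>
  also have "{i. i \<in> {1..k} \<and> f i = (Some \<sigma>, Suc 0)} = {i. i \<le> k \<and> f i = (Some \<sigma>, Suc 0)}"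
    using assms(1) by (auto simp: Suc_le_eq intro!: gr0I)
  finally show ?thesis .
qed

text \<open>Since \<open>h\<close> is injective, moving \<open>m\<close> to the finite subset
  enumerated by \<open>h\<close> collects exactly the coefficients of the chain. This links equality
  in the colimit to equality of chains.\<close>

lemma lookup_rep_chain_factor:
  assumes "h 0 = (None, 0)" "h ` {..n} \<subseteq> pointed S" "inj_on h {..n}"
    and "u \<in> gamma_map k n" "\<And>i. i \<le> k \<Longrightarrow> f i = h (u i)"
    and "p \<in> {1..n}" "h p = (Some \<sigma>, Suc 0)"
  shows "Poly_Mapping.lookup (rep_chain (k, f, m)) \<sigma> = HR_map k n u m p"
proof -
  have u: "u 0 = 0" "\<And>i. i \<le> k \<Longrightarrow> u i \<le> n"
    using assms(4) by (auto simp: gamma_map_def)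
  have "f 0 = (None, 0)" "f ` {..k} \<subseteq> pointed S"
    using assms(1,2) u by (auto simp: assms(5) image_subset_iff)
  then have "Poly_Mapping.lookup (rep_chain (k, f, m)) \<sigma> = (\<Sum>i | i \<le> k \<and> f i = (Some \<sigma>, Suc 0). m i)"
    by (rule lookup_rep_chain)
  also have "{i. i \<le> k \<and> f i = (Some \<sigma>, Suc 0)} = {i. i \<le> k \<and> u i = p}"
    using assms(5-7) u(2) inj_onD [OF assms(3)] by fastforce
  finally show ?thesis
    using assms(6) by (simp add: HR_map_def)
qed

lemma finite_pointed_enumeration:
  assumes "finite F" "b \<in> F"
  obtains n :: nat and h where "bij_betw h {..n} F" "h 0 = b"
proof -
  obtain h where h: "bij_betw h {1..card (F - {b})} (F - {b})"
    using ex_bij_betw_nat_finite_1 [of "F - {b}"] assms(1) by auto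
  let ?h = "h(0 := b)"
  have "bij_betw ?h {1..card (F - {b})} (F - {b})"
    using h by (subst bij_betw_cong [where g = h]) auto
  then have "bij_betw ?h ({1..card (F - {b})} \<union> {0}) ((F - {b}) \<union> {b})"
    by (rule bij_betw_combine) auto
  moreover have "{1..card (F - {b})} \<union> {0} = {..card (F - {b})}" by auto
  ultimately show thesis
    using that [of ?h "card (F - {b})"] assms(2) by (simp add: insert_absorb)
qed

text \<open>Both \<open>HR\<close> and \<open>HR_norm lam\<close> are instances, so the passage to
  chains is carried out once for the two ends of the canonical map.\<close>

locale HR_submodule =
  fixes M :: "(nat \<Rightarrow> real) smod"
  assumes s_module: "s_module M"
    and set_subset: "sm_set M k \<subseteq> sm_set HR k"
    and pt_eq: "sm_pt M = sm_pt HR"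
    and map_eq: "sm_map M = sm_map HR"
begin

text \<open>Over a common finite subset, both vectors of coefficients are read off from the chains;
  simplices outside that subset have coefficient 0 on both sides.\<close>

lemma ext_rel_eq:
  "ext_rel M (pointed S) (None, 0) = {(r, s). r \<in> ext_rep M (pointed S) (None, 0) \<and>
     s \<in> ext_rep M (pointed S) (None, 0) \<and> rep_chain r = rep_chain s}"
proof -
  let ?b = "(None, 0) :: 'e option \<times> nat"
  have "(\<exists>n h. inj_on h {..n} \<and> h 0 = ?b \<and> h ` {..n} \<subseteq> pointed S \<and>
       (\<exists>u\<in>gamma_map k n. \<exists>v\<in>gamma_map l n.
          (\<forall>i\<le>k. f i = h (u i)) \<and> (\<forall>i\<le>l. g i = h (v i)) \<and> sm_map M k n u m = sm_map M l n v m'))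
     \<longleftrightarrow> rep_chain (k, f, m) = rep_chain (l, g, m')" (is "?L \<longleftrightarrow> ?R")
    if "(k, f, m) \<in> ext_rep M (pointed S) ?b" "(l, g, m') \<in> ext_rep M (pointed S) ?b" for k f m l g m'
  proof
    have f: "f 0 = ?b" "f ` {..k} \<subseteq> pointed S" and g: "g 0 = ?b" "g ` {..l} \<subseteq> pointed S"
      using that by (auto simp: ext_rep_def)
    show ?R if ?L
    proof (rule poly_mapping_eqI)
      fix \<sigma>
      obtain n h u v where h: "h 0 = ?b" "h ` {..n} \<subseteq> pointed S" "inj_on h {..n}"
        and u: "u \<in> gamma_map k n" "\<And>i. i \<le> k \<Longrightarrow> f i = h (u i)"
        and v: "v \<in> gamma_map l n" "\<And>i. i \<le> l \<Longrightarrow> g i = h (v i)"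
        and eq: "HR_map k n u m = HR_map l n v m'"
        using \<open>?L\<close> by (auto simp: map_eq HR_sel)
      show "Poly_Mapping.lookup (rep_chain (k, f, m)) \<sigma> = Poly_Mapping.lookup (rep_chain (l, g, m')) \<sigma>"
      proof (cases "(Some \<sigma>, Suc 0) \<in> h ` {..n}")
        case True
        then obtain p where p: "p \<le> n" "h p = (Some \<sigma>, Suc 0)" by auto
        with h(1) have "p \<in> {1..n}" by (cases "p = 0") auto
        then show ?thesis
          using lookup_rep_chain_factor [OF h u _ p(2)] lookup_rep_chain_factor [OF h v _ p(2)] eq
          by simp
      next
        case False
        have "i \<le> k \<Longrightarrow> f i \<in> h ` {..n}" "i \<le> l \<Longrightarrow> g i \<in> h ` {..n}" for i
          using u v by (auto simp: gamma_map_def)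
        with False have "i \<le> k \<Longrightarrow> f i \<noteq> (Some \<sigma>, Suc 0)" "i \<le> l \<Longrightarrow> g i \<noteq> (Some \<sigma>, Suc 0)" for i
          by metis+
        then have "{i. i \<le> k \<and> f i = (Some \<sigma>, Suc 0)} = {}" "{i. i \<le> l \<and> g i = (Some \<sigma>, Suc 0)} = {}"
          by blast+
        then show ?thesis
          unfolding lookup_rep_chain [OF f] lookup_rep_chain [OF g] by (simp only: sum.empty)
      qed
    qed
    show ?L if ?R
    proof -
      \<comment> \<open>The smallest finite pointed subset through which both maps factor.\<close>
      let ?F = "f ` {..k} \<union> g ` {..l}"
      have "?b \<in> ?F" using f(1) by (metis UnI1 atMost_iff image_eqI le0)
      then obtain n :: nat and h where h: "bij_betw h {..n} ?F" "h 0 = ?b"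
        using finite_pointed_enumeration [of ?F ?b] by blast
      let ?i = "inv_into {..n} h"
      have inj: "inj_on h {..n}" and im: "h ` {..n} = ?F" using h(1) by (auto simp: bij_betw_def)
      have hE: "h ` {..n} \<subseteq> pointed S" using f g im by blast
      have i0: "?i ?b = 0" using inv_into_f_f [OF inj, of 0] h(2) by simp
      have i: "?i y \<le> n" "h (?i y) = y" if "y \<in> ?F" for y
        using inv_into_into [of y h "{..n}"] f_inv_into_f [of y h "{..n}"] that im by auto
      have ifg: "j \<le> k \<Longrightarrow> ?i (f j) \<le> n" "j \<le> k \<Longrightarrow> h (?i (f j)) = f j"
        "j \<le> l \<Longrightarrow> ?i (g j) \<le> n" "j \<le> l \<Longrightarrow> h (?i (g j)) = g j" for j
        using i [of "f j"] i [of "g j"] by simp_all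
      have u: "?i \<circ> f \<in> gamma_map k n" "\<And>j. j \<le> k \<Longrightarrow> f j = h ((?i \<circ> f) j)"
        using ifg i0 f(1) by (auto simp: gamma_map_def)
      have v: "?i \<circ> g \<in> gamma_map l n" "\<And>j. j \<le> l \<Longrightarrow> g j = h ((?i \<circ> g) j)"
        using ifg i0 g(1) by (auto simp: gamma_map_def)
      have "HR_map k n (?i \<circ> f) m p = HR_map l n (?i \<circ> g) m' p" for p
      proof (cases "p \<in> {1..n}")
        case True
        then have "h p \<noteq> h 0" using inj_onD [OF inj, of p 0] by auto
        moreover have "h p \<in> pointed S" using hE True by auto
        ultimately obtain \<sigma> where "h p = (Some \<sigma>, Suc 0)" using h(2) unfolding in_pointed_iff by metis
        then show ?thesis
          using lookup_rep_chain_factor [OF h(2) hE inj u True] \<open>?R\<close>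
            lookup_rep_chain_factor [OF h(2) hE inj v True] by metis
      next
        case False
        then show ?thesis by (metis HR_map_outside)
      qed
      then show ?L
        using inj h(2) hE u v unfolding map_eq HR_sel by blast
    qed
  qed
  then show ?thesis
    unfolding ext_rel_def
    by (simp only: set_eq_iff split_paired_All mem_Collect_eq case_prod_conv cong: conj_cong) simp
qed

text \<open>The nonempty fibers are the elements of the colimit. For \<open>HR_norm lam\<close> the
  fiber is empty once the norm of \<open>c\<close> reaches \<open>lam\<close>.\<close>

definition fiber :: "'e set \<Rightarrow> ('e \<Rightarrow>\<^sub>0 real) \<Rightarrow> ('e option \<times> nat, nat \<Rightarrow> real) ext" where
  "fiber S c = {r \<in> ext_rep M (pointed S) (None, 0). rep_chain r = c}"

lemma ext_rel_class:
  "r \<in> ext_rep M (pointed S) (None, 0) \<Longrightarrow>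
     ext_rel M (pointed S) (None, 0) `` {r} = fiber S (rep_chain r)"
  by (auto simp: ext_rel_eq fiber_def)

lemma the_elem_fiber:
  "r \<in> ext_rep M (pointed S) (None, 0) \<Longrightarrow> the_elem (rep_chain ` fiber S (rep_chain r)) = rep_chain r"
  by (rule the_elem_image_unique) (unfold fiber_def, blast+)

lemma ext_chain_fiber:
  "r \<in> ext_rep M (pointed S) (None, 0) \<Longrightarrow> ext_chain (fiber S (rep_chain r)) = rep_chain r"
  by (simp add: ext_chain_eq the_elem_fiber)

lemma fiber_in_ext_set:
  "r \<in> ext_rep M (pointed S) (None, 0) \<Longrightarrow> fiber S (rep_chain r) \<in> ext_set M (pointed S) (None, 0)"
  by (metis ext_rel_class ext_set_def quotientI)

lemma ext_setE:
  assumes "x \<in> ext_set M (pointed S) (None, 0)"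
  obtains r where "r \<in> ext_rep M (pointed S) (None, 0)" "x = fiber S (rep_chain r)" "r \<in> x"
proof -
  obtain r where r: "r \<in> ext_rep M (pointed S) (None, 0)" "x = fiber S (rep_chain r)"
    using assms unfolding ext_set_def by (metis ext_rel_class quotientE)
  then show thesis using that by (simp add: fiber_def)
qed

lemma ext_chain_inj:
  assumes "x \<in> ext_set M (pointed S) (None, 0)" "y \<in> ext_set M (pointed S) (None, 0)"
    and "ext_chain x = ext_chain y"
  shows "x = y"
  using assms by (metis ext_setE ext_chain_fiber)

lemma zero_in_ext_rep: "(0, \<lambda>_. (None, 0), \<lambda>_. 0) \<in> ext_rep M (pointed S) (None, 0)"
proof -
  have "sm_pt M 0 \<in> sm_set M 0" using s_module by (simp add: s_module_def)
  then show ?thesis by (auto simp: ext_rep_def pt_eq HR_sel in_pointed_iff)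
qed

lemma ext_pt_eq: "ext_pt M (pointed S) (None, 0) = fiber S 0"
  using ext_rel_class [OF zero_in_ext_rep] by (simp add: ext_pt_def pt_eq HR_sel rep_chain_def)

lemma ext_pt_in_ext_set: "ext_pt M (pointed S) (None, 0) \<in> ext_set M (pointed S) (None, 0)"
  using fiber_in_ext_set [OF zero_in_ext_rep] by (simp add: ext_pt_eq rep_chain_def)

lemma ext_chain_pt: "ext_chain (ext_pt M (pointed S) (None, 0)) = 0"
  using ext_chain_fiber [OF zero_in_ext_rep] by (simp add: ext_pt_eq rep_chain_def)

lemma keys_ext_chain:
  assumes "x \<in> ext_set M (pointed S) (None, 0)"
  shows "Poly_Mapping.keys (ext_chain x) \<subseteq> S"
proof
  fix \<sigma> assume \<sigma>: "\<sigma> \<in> Poly_Mapping.keys (ext_chain x)"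
  obtain k f m where r: "(k, f, m) \<in> ext_rep M (pointed S) (None, 0)" "x = fiber S (rep_chain (k, f, m))"
    using ext_setE [OF assms] by (metis prod_cases3)
  then have f: "f 0 = (None, 0)" "f ` {..k} \<subseteq> pointed S" by (auto simp: ext_rep_def)
  have "(\<Sum>i | i \<le> k \<and> f i = (Some \<sigma>, Suc 0). m i) \<noteq> 0"
    using \<sigma> r by (simp add: ext_chain_fiber in_keys_iff lookup_rep_chain [OF f])
  then have "{i. i \<le> k \<and> f i = (Some \<sigma>, Suc 0)} \<noteq> {}" by (metis sum.empty)
  then obtain i where "i \<le> k" "f i = (Some \<sigma>, Suc 0)" by auto
  then have "(Some \<sigma>, Suc 0) \<in> pointed S" using f(2) by (metis atMost_iff image_subset_iff)
  then show "\<sigma> \<in> S" by (simp add: in_pointed_iff)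
qed

text \<open>On representatives the map only relabels simplices, which on chains is a pushforward.
  The union defining \<open>ext_map\<close> therefore consists of copies of a single class.\<close>

lemma ext_map_fiber:
  assumes x: "x \<in> ext_set M (pointed S) (None, 0)"
    and g: "g ` S \<subseteq> S'" and u: "u (None, 0) = (None, 0)" "\<And>\<sigma>. \<sigma> \<in> S \<Longrightarrow> u (Some \<sigma>, Suc 0) = (Some (g \<sigma>), Suc 0)"
  shows "ext_map M (pointed S') (None, 0) u x \<in> ext_set M (pointed S') (None, 0)"
    and "ext_chain (ext_map M (pointed S') (None, 0) u x) = push g (ext_chain x)"
proof -
  have rep: "(k, u \<circ> f, m) \<in> ext_rep M (pointed S') (None, 0)"
    if "(k, f, m) \<in> ext_rep M (pointed S) (None, 0)" for k f m
  proof -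
    have "u y \<in> pointed S'" if "y \<in> pointed S" for y
      using that g u unfolding in_pointed_iff by blast
    then show ?thesis
      using that u(1) by (auto simp: ext_rep_def image_subset_iff)
  qed
  have chain: "rep_chain (k, u \<circ> f, m) = push g (rep_chain (k, f, m))"
    if "(k, f, m) \<in> ext_rep M (pointed S) (None, 0)" for k f m
    unfolding rep_chain_def case_prod_conv push_sum
  proof (rule sum.cong)
    fix i assume "i \<in> {1..k}"
    then have "f i \<in> pointed S" using that by (auto simp: ext_rep_def)
    then show "(case (u \<circ> f) i of (None, _) \<Rightarrow> 0 | (Some \<sigma>, _) \<Rightarrow> Poly_Mapping.single \<sigma> (m i))
        = push g (case f i of (None, _) \<Rightarrow> 0 | (Some \<sigma>, _) \<Rightarrow> Poly_Mapping.single \<sigma> (m i))"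
      using u by (auto simp: in_pointed_iff push_single)
  qed simp
  obtain k f m where r: "(k, f, m) \<in> ext_rep M (pointed S) (None, 0)"
    "x = fiber S (rep_chain (k, f, m))" "(k, f, m) \<in> x"
    using ext_setE [OF x] by (metis prod_cases3)
  have "ext_rel M (pointed S') (None, 0) `` {(k', u \<circ> f', m')} = fiber S' (push g (rep_chain (k, f, m)))"
    if "(k', f', m') \<in> x" for k' f' m'
    using that r(2) ext_rel_class [OF rep] chain by (auto simp: fiber_def)
  then have "ext_map M (pointed S') (None, 0) u x = fiber S' (push g (rep_chain (k, f, m)))"
    using r(3) unfolding ext_map_def by fastforce
  also have "\<dots> = fiber S' (rep_chain (k, u \<circ> f, m))"
    using chain [OF r(1)] by simp
  finally have eq: "ext_map M (pointed S') (None, 0) u x = fiber S' (rep_chain (k, u \<circ> f, m))" .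
  show "ext_map M (pointed S') (None, 0) u x \<in> ext_set M (pointed S') (None, 0)"
    unfolding eq by (rule fiber_in_ext_set [OF rep [OF r(1)]])
  show "ext_chain (ext_map M (pointed S') (None, 0) u x) = push g (ext_chain x)"
  proof -
    have "ext_chain (ext_map M (pointed S') (None, 0) u x) = rep_chain (k, u \<circ> f, m)"
      unfolding eq by (rule ext_chain_fiber [OF rep [OF r(1)]])
    then show ?thesis
      unfolding chain [OF r(1)] r(2) ext_chain_fiber [OF r(1)] .
  qed
qed

end

interpretation HR: HR_submodule HR
  by unfold_locales (auto simp: s_module_HR)

lemma HR_submodule_HR_norm: "lam > 0 \<Longrightarrow> HR_submodule (HR_norm lam)"
  by unfold_locales (auto simp: s_module_HR_norm HR_norm_sel)

context HR_submodule
begin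

lemma ext_trans_HR:
  assumes x: "x \<in> ext_set M (pointed S) (None, 0)"
  shows "ext_trans HR (pointed S) (None, 0) (\<lambda>k m. m) x \<in> ext_set HR (pointed S) (None, 0)"
    and "ext_chain (ext_trans HR (pointed S) (None, 0) (\<lambda>k m. m) x) = ext_chain x"
proof -
  have rep: "r \<in> ext_rep HR (pointed S) (None, 0)" if "r \<in> ext_rep M (pointed S) (None, 0)" for r
    using that set_subset by (auto simp: ext_rep_def)
  obtain r where r: "r \<in> ext_rep M (pointed S) (None, 0)" "x = fiber S (rep_chain r)" "r \<in> x"
    using ext_setE [OF x] .
  have "ext_rel HR (pointed S) (None, 0) `` {s} = HR.fiber S (rep_chain r)" if "s \<in> x" for s
    using that r(2) HR.ext_rel_class [OF rep] by (auto simp: fiber_def)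
  then have eq: "ext_trans HR (pointed S) (None, 0) (\<lambda>k m. m) x = HR.fiber S (rep_chain r)"
    using r(3) unfolding ext_trans_def by fastforce
  show "ext_trans HR (pointed S) (None, 0) (\<lambda>k m. m) x \<in> ext_set HR (pointed S) (None, 0)"
    unfolding eq by (rule HR.fiber_in_ext_set [OF rep [OF r(1)]])
  show "ext_chain (ext_trans HR (pointed S) (None, 0) (\<lambda>k m. m) x) = ext_chain x"
    unfolding eq HR.ext_chain_fiber [OF rep [OF r(1)]] using r(2) ext_chain_fiber [OF r(1)] by simp
qed

end

section \<open>The canonical map in terms of chains\<close>

lemma smash_sing_sel:
  "ss_set (smash (sing X) 1) q = pointed (singular_simplex_set q X)"
  "ss_pt (smash (sing X) 1) q = (None, 0)"
  "ss_map (smash (sing X) 1) p q \<theta> (None, 0) = (None, 0)"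
  "ss_map (smash (sing X) 1) p q \<theta> (Some \<sigma>, Suc 0) = (Some (simplex_pullback p q \<theta> \<sigma>), Suc 0)"
proof -
  let ?P = "insert None (Some ` singular_simplex_set q X) \<times> {..1}"
  have "smash_pair None ` ?P = pointed (singular_simplex_set q X)"
  proof
    show "smash_pair None ` ?P \<subseteq> pointed (singular_simplex_set q X)"
      by (auto simp: in_pointed_iff smash_pair_def le_Suc_eq)
    have "smash_pair None y = y" "y \<in> ?P" if "y \<in> pointed (singular_simplex_set q X)" for y
      using that by (auto simp: in_pointed_iff smash_pair_def)
    then show "pointed (singular_simplex_set q X) \<subseteq> smash_pair None ` ?P"
      by (metis image_eqI subsetI)
  qed
  then show "ss_set (smash (sing X) 1) q = pointed (singular_simplex_set q X)"
    by (simp add: smash_def sing_def)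
qed (simp_all add: smash_def sing_def smash_pair_def)

definition sing_comp :: "(nat \<Rightarrow> real) smod \<Rightarrow> 'a topology
    \<Rightarrow> (((nat \<Rightarrow> real) \<Rightarrow> 'a) option \<times> nat, nat \<Rightarrow> real) ext psset" where
  "sing_comp M X = smod_comp M (smash (sing X) 1)"

lemma sing_comp_sel:
  "ss_set (sing_comp M X) q = ext_set M (pointed (singular_simplex_set q X)) (None, 0)"
  "ss_pt (sing_comp M X) q = ext_pt M (pointed (singular_simplex_set q X)) (None, 0)"
  "ss_face (sing_comp M X) q j = ext_map M (pointed (singular_simplex_set (q - 1) X)) (None, 0)
     (ss_map (smash (sing X) 1) (q - 1) q (coface j))"
  unfolding sing_comp_def smod_comp_def ss_face_def psset.select_convs smash_sing_sel
  by (rule refl)+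

context HR_submodule
begin

lemma face_sing_comp:
  assumes x: "x \<in> ss_set (sing_comp M X) q" and q: "q > 0" "j \<le> q"
  shows "ss_face (sing_comp M X) q j x \<in> ss_set (sing_comp M X) (q - 1)"
    and "ext_chain (ss_face (sing_comp M X) q j x) = push (singular_face q j) (ext_chain x)"
proof -
  let ?u = "ss_map (smash (sing X) 1) (q - 1) q (coface j)"
  have g: "singular_face q j ` singular_simplex_set q X \<subseteq> singular_simplex_set (q - 1) X"
    using singular_simplex_singular_face [of q X _ j] q by auto
  have u: "?u (None, 0) = (None, 0)" "\<And>\<sigma>. ?u (Some \<sigma>, Suc 0) = (Some (singular_face q j \<sigma>), Suc 0)"
    by (simp_all only: smash_sing_sel singular_face_eq_pullback [OF q])
  note * = ext_map_fiber [OF x [unfolded sing_comp_sel] g u]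
  show "ss_face (sing_comp M X) q j x \<in> ss_set (sing_comp M X) (q - 1)"
    "ext_chain (ss_face (sing_comp M X) q j x) = push (singular_face q j) (ext_chain x)"
    unfolding sing_comp_sel by (rule *)+
qed

text \<open>The base point has chain 0, and injectivity of \<open>ext_chain\<close> carries the
  equation back from chains.\<close>

lemma face_sing_comp_eq_pt_iff:
  assumes "x \<in> ss_set (sing_comp M X) q" "q > 0" "j \<le> q"
  shows "ss_face (sing_comp M X) q j x = ss_pt (sing_comp M X) (q - 1)
     \<longleftrightarrow> push (singular_face q j) (ext_chain x) = 0"
  using face_sing_comp [OF assms] ext_chain_inj ext_pt_in_ext_set ext_chain_pt
  by (metis sing_comp_sel(1,2))

lemma comb_Z_sing_comp_iff:
  "x \<in> comb_Z n (sing_comp M X) \<longleftrightarrow> x \<in> ss_set (sing_comp M X) n \<and>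
     (n \<noteq> 0 \<longrightarrow> (\<forall>j\<le>n. push (singular_face n j) (ext_chain x) = 0))"
  unfolding comb_Z_def using face_sing_comp_eq_pt_iff [of x X n] by blast

lemma rchain_ext_chain:
  "x \<in> ss_set (sing_comp M X) n \<Longrightarrow> rchain n X (ext_chain x)"
  unfolding sing_comp_sel rchain_def by (rule keys_ext_chain)

lemma rcycle_ext_chain:
  assumes "x \<in> comb_Z n (sing_comp M X)"
  shows "ext_chain x \<in> rcycle_set n X"
proof -
  have "rboundary n (ext_chain x) = 0"
  proof (cases "n = 0")
    case False
    then have "push (singular_face n j) (ext_chain x) = 0" if "j \<le> n" for j
      using assms that by (simp add: comb_Z_sing_comp_iff)
    with False show ?thesis by (simp add: rboundary_eq)
  qed (simp add: rboundary_def)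
  then show ?thesis
    using assms by (simp add: rcycle_set_def comb_Z_sing_comp_iff rchain_ext_chain)
qed

text \<open>Only the last two faces of a witness \<open>z\<close> survive, with opposite signs. Its
  boundary is the difference up to the factor \<open>(-1) ^ n\<close>, which rescaling
  \<open>z\<close> removes.\<close>

lemma comb_R_imp_rhomologous:
  assumes "(x, y) \<in> comb_R n (sing_comp M X)"
  shows "rhomologous_rel n X {} (ext_chain x) (ext_chain y)"
proof -
  let ?Y = "sing_comp M X"
  obtain z where z: "z \<in> ss_set ?Y (Suc n)" "\<And>j. j < n \<Longrightarrow> ss_face ?Y (Suc n) j z = ss_pt ?Y n"
    "ss_face ?Y (Suc n) n z = x" "ss_face ?Y (Suc n) (Suc n) z = y"
    using assms by (auto simp: comb_R_def)
  have zero: "push (singular_face (Suc n) j) (ext_chain z) = 0" if "j < n" for j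
    using face_sing_comp_eq_pt_iff [OF z(1), of j] z(2) that by simp
  have xy: "push (singular_face (Suc n) n) (ext_chain z) = ext_chain x"
    "push (singular_face (Suc n) (Suc n)) (ext_chain z) = ext_chain y"
    using face_sing_comp(2) [OF z(1)] z(3,4) by auto
  have "{..Suc n} = insert (Suc n) (insert n {..<n})" by auto
  then have "rboundary (Suc n) (ext_chain z) = rscale ((-1) ^ n) (ext_chain x - ext_chain y)"
    by (intro poly_mapping_eqI)
      (simp add: rboundary_eq lookup_sum lookup_add lookup_minus zero xy algebra_simps)
  then have "rboundary (Suc n) (rscale ((-1) ^ n) (ext_chain z)) = ext_chain x - ext_chain y"
    by (intro poly_mapping_eqI) (simp add: rboundary_scale flip: power_mult_distrib mult.assoc)
  then show ?thesis
    unfolding rhomologous_empty_iff using rchain_scale [OF rchain_ext_chain [OF z(1)]] by blast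
qed

lemma comb_rel_imp_rhomologous:
  "(x, y) \<in> comb_rel n (sing_comp M X) \<Longrightarrow> rhomologous_rel n X {} (ext_chain x) (ext_chain y)"
  unfolding comb_rel_def
proof (induction rule: rtrancl_induct)
  case (step y z)
  then have "rhomologous_rel n X {} (ext_chain y) (ext_chain z)"
    using comb_R_imp_rhomologous rhomologous_sym by blast
  with step.IH show ?case by (rule rhomologous_trans)
qed (rule rhomologous_refl)

end

text \<open>As a reflexive closure \<open>comb_rel\<close> relates every element of the type to
  itself, but its generating pairs lie in \<open>comb_Z\<close>.\<close>

lemma comb_rel_in_comb_Z:
  assumes "(x, y) \<in> comb_rel n Y" "x \<in> comb_Z n Y"
  shows "y \<in> comb_Z n Y"
  using assms unfolding comb_rel_def
  by (induction rule: rtrancl_induct) (auto simp: comb_R_def)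

text \<open>The map is a union over all elements of a class and of its image class. Related elements
  have homologous chains, so all sets in the union coincide.\<close>

lemma (in HR_submodule) canonical_map_class:
  assumes x: "x \<in> comb_Z n (sing_comp M X)"
  shows "canonical_map n X (comb_rel n (sing_comp M X) `` {x}) = rhomology_class n X (ext_chain x)"
proof -
  let ?T = "ext_trans HR (ss_set (smash (sing X) 1) n) (ss_pt (smash (sing X) 1) n) (\<lambda>k m. m)"
  let ?C = "comb_rel n (sing_comp M X) `` {x}"
  have eq: "canonical_map n X ?C
      = (\<Union>x'\<in>?C. \<Union>y\<in>comb_rel n (sing_comp HR X) `` {?T x'}. rhomology_class n X (ext_chain y))"
    by (auto simp: canonical_map_def HR_homology_ident_def smod_homology_trans_def pi_map_def sing_comp_def)
  have "rhomology_class n X (ext_chain y) = rhomology_class n X (ext_chain x)"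
    if "x' \<in> ?C" "y \<in> comb_rel n (sing_comp HR X) `` {?T x'}" for x' y
  proof -
    have "x' \<in> comb_Z n (sing_comp M X)"
      using comb_rel_in_comb_Z [OF _ x] that(1) by blast
    then have "ext_chain (?T x') = ext_chain x'"
      unfolding smash_sing_sel by (intro ext_trans_HR) (simp add: comb_Z_def sing_comp_sel)
    moreover have "rhomologous_rel n X {} (ext_chain x) (ext_chain x')"
      using comb_rel_imp_rhomologous that(1) by blast
    moreover have "rhomologous_rel n X {} (ext_chain (?T x')) (ext_chain y)"
      using HR.comb_rel_imp_rhomologous that(2) by blast
    ultimately show ?thesis
      by (metis rhomology_class_eq)
  qed
  moreover have "x \<in> ?C" "?T x \<in> comb_rel n (sing_comp HR X) `` {?T x}"
    by (simp_all add: comb_rel_def)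
  ultimately show ?thesis
    unfolding eq by blast
qed

section \<open>The chains that come from the norm-bounded module\<close>

lemma l1_norm_ext_chain_HR_norm:
  assumes "lam > 0" "x \<in> ext_set (HR_norm lam) (pointed S) (None, 0)"
  shows "l1_norm (ext_chain x) < lam"
proof -
  interpret HR_submodule "HR_norm lam" using assms(1) by (rule HR_submodule_HR_norm)
  obtain k f m where r: "(k, f, m) \<in> ext_rep (HR_norm lam) (pointed S) (None, 0)"
    "x = fiber S (rep_chain (k, f, m))"
    using ext_setE [OF assms(2)] by (metis prod_cases3)
  \<comment> \<open>A representative may list a simplex several times or hit the base point; both
    can only lower the norm of the chain.\<close>
  have "l1_norm (rep_chain (k, f, m)) \<le> (\<Sum>i=1..k. l1_norm (case f i of (None, _) \<Rightarrow> 0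
      | (Some \<sigma>, _) \<Rightarrow> Poly_Mapping.single \<sigma> (m i)))"
    unfolding rep_chain_def case_prod_conv by (rule l1_norm_sum)
  also have "\<dots> \<le> (\<Sum>i=1..k. \<bar>m i\<bar>)"
    by (intro sum_mono) (auto split: prod.split option.split simp: l1_norm_def [of 0])
  also have "\<dots> < lam"
    using r(1) by (simp add: ext_rep_def HR_norm_sel)
  finally show ?thesis
    unfolding r(2) ext_chain_fiber [OF r(1)] .
qed

text \<open>Enumerating the support without repetition gives a representative whose coefficient sum
  equals the norm, so the strict bound is inherited.\<close>

lemma ext_chain_HR_norm_surj:
  assumes "lam > 0" "Poly_Mapping.keys c \<subseteq> S" "l1_norm c < lam"
  obtains x where "x \<in> ext_set (HR_norm lam) (pointed S) (None, 0)" "ext_chain x = c"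
proof -
  interpret HR_submodule "HR_norm lam" using assms(1) by (rule HR_submodule_HR_norm)
  define n where "n = card (Poly_Mapping.keys c)"
  obtain h where h: "bij_betw h {1..n} (Poly_Mapping.keys c)"
    using ex_bij_betw_nat_finite_1 [of "Poly_Mapping.keys c"] by (auto simp: n_def)
  \<comment> \<open>Outside \<open>{1..n}\<close> the defaults are forced: index 0 must go to the
    base point, and \<open>m\<close> must vanish there to be a vector of length
    \<open>n\<close>.\<close>
  define f where "f i = (if i \<in> {1..n} then (Some (h i), Suc 0) else (None, 0))" for i
  define m where "m i = (if i \<in> {1..n} then Poly_Mapping.lookup c (h i) else 0)" for i
  have "(\<Sum>i=1..n. \<bar>m i\<bar>) = (\<Sum>i=1..n. \<bar>Poly_Mapping.lookup c (h i)\<bar>)"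
    by (intro sum.cong) (auto simp: m_def)
  also have "\<dots> = l1_norm c"
    unfolding l1_norm_def by (rule sum.reindex_bij_betw [OF h])
  finally have r: "(n, f, m) \<in> ext_rep (HR_norm lam) (pointed S) (None, 0)"
    using assms(3) subsetD [OF assms(2) bij_betwE [OF h, rule_format]]
    by (auto simp: ext_rep_def HR_norm_sel HR_sel f_def m_def in_pointed_iff)
  have "rep_chain (n, f, m) = (\<Sum>i=1..n. Poly_Mapping.single (h i) (Poly_Mapping.lookup c (h i)))"
    unfolding rep_chain_def case_prod_conv by (intro sum.cong) (auto simp: f_def m_def)
  also have "\<dots> = push (\<lambda>\<sigma>. \<sigma>) c"
    unfolding push_def by (rule sum.reindex_bij_betw [OF h])
  also have "\<dots> = c" by (rule push_id) simp
  finally show thesis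
    using that fiber_in_ext_set [OF r] ext_chain_fiber [OF r] by simp
qed

theorem theorem1p4:
  fixes \<Sigma> :: "'a topology"
    and A :: "('a set \<times> ('a \<Rightarrow> complex)) set"
    and \<alpha> :: "'a rchain set"
    and lam :: real
  assumes "riemann_surface \<Sigma> A"
    and "compact_space \<Sigma>"
    and "fundamental_class \<Sigma> A \<alpha>"
    and "lam > 0"
  shows "\<alpha> \<in> canonical_map 2 \<Sigma> ` sm_set (smod_homology 2 (sing \<Sigma>) (HR_norm lam)) 1
           \<longleftrightarrow> lam > gromov_norm 2 \<Sigma> \<alpha>"
proof -
  interpret HR_submodule "HR_norm lam" using assms(4) by (rule HR_submodule_HR_norm)
  let ?Y = "sing_comp (HR_norm lam) \<Sigma>"
  let ?N = "l1_norm ` {c \<in> rcycle_set 2 \<Sigma>. rhomology_class 2 \<Sigma> c = \<alpha>}"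
  have "sm_set (smod_homology 2 (sing \<Sigma>) (HR_norm lam)) 1 = (\<lambda>x. comb_rel 2 ?Y `` {x}) ` comb_Z 2 ?Y"
    by (auto simp: smod_homology_def pi_comb_def quotient_def sing_comp_def)
  then have range: "\<alpha> \<in> canonical_map 2 \<Sigma> ` sm_set (smod_homology 2 (sing \<Sigma>) (HR_norm lam)) 1
      \<longleftrightarrow> (\<exists>x\<in>comb_Z 2 ?Y. \<alpha> = rhomology_class 2 \<Sigma> (ext_chain x))"
    by (simp add: image_image canonical_map_class image_iff cong: bex_cong_simp)
  show ?thesis
    unfolding range
  proof
    assume "\<exists>x\<in>comb_Z 2 ?Y. \<alpha> = rhomology_class 2 \<Sigma> (ext_chain x)"
    then obtain x where x: "x \<in> comb_Z 2 ?Y" "\<alpha> = rhomology_class 2 \<Sigma> (ext_chain x)" by blast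
    \<comment> \<open>A real infimum is a lower bound only when the set is bounded below.\<close>
    have "bdd_below ?N" by (rule bdd_belowI2 [where m = 0]) (rule l1_norm_nonneg)
    then have "gromov_norm 2 \<Sigma> \<alpha> \<le> l1_norm (ext_chain x)"
      unfolding gromov_norm_def using x rcycle_ext_chain by (intro cInf_lower) auto
    also have "\<dots> < lam"
      using assms(4) x(1) by (intro l1_norm_ext_chain_HR_norm) (auto simp: comb_Z_def sing_comp_sel)
    finally show "gromov_norm 2 \<Sigma> \<alpha> < lam" .
  next
    assume less: "gromov_norm 2 \<Sigma> \<alpha> < lam"
    \<comment> \<open>A homology class contains the cycle that defines it. Nonemptiness lets an
      infimum below \<open>lam\<close> yield a cycle of norm below \<open>lam\<close>.\<close>
    have "?N \<noteq> {}"
      using assms(3) by (auto simp: fundamental_class_def rhomology_def)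
    then obtain c where c: "c \<in> rcycle_set 2 \<Sigma>" "rhomology_class 2 \<Sigma> c = \<alpha>" "l1_norm c < lam"
      using cInf_lessD [of ?N lam] less by (auto simp: gromov_norm_def)
    then have cycle: "rchain 2 \<Sigma> c" "rboundary 2 c = 0" by (auto simp: rcycle_set_def)
    have "l1_norm (antisymmetrization c) < lam" using l1_norm_antisymmetrization c(3) by (rule le_less_trans)
    then obtain x where x: "x \<in> ext_set (HR_norm lam) (pointed (singular_simplex_set 2 \<Sigma>)) (None, 0)"
      "ext_chain x = antisymmetrization c"
      using ext_chain_HR_norm_surj [OF assms(4)] rchain_antisymmetrization [OF cycle(1)] unfolding rchain_def by metis
    have "x \<in> comb_Z 2 ?Y"
      using x face_antisymmetrization [OF cycle] by (simp add: comb_Z_sing_comp_iff sing_comp_sel)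
    moreover have "\<alpha> = rhomology_class 2 \<Sigma> (ext_chain x)"
      using rhomology_class_eq [OF antisymmetrization_homologous [OF cycle]] c(2) x(2) by simp
    ultimately show "\<exists>x\<in>comb_Z 2 ?Y. \<alpha> = rhomology_class 2 \<Sigma> (ext_chain x)" by blast
  qed
qed

end
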